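(* Let $q$ and $n$ be positive integers and let $\delta=\lceil \min\{\log_2 q,\log_2 n\}\rceil$. In the cell-probe model with $w$ bits per cell, for any randomised algorithm solving the online Hamming distance problem (with alphabet $[q]$ and pattern length $n$), there exist instances such that the expected amortised time per arriving value is $\Omega\left(\frac{\delta}{w}\log n\right)$.
   Context: Online Hamming distance problem: a string $F$ of length $n$ over the alphabet $[q]=\{0,\dots,q-1\}$ is fixed (known in advance). Symbols from $[q]$ arrive one at a time in a stream. For each arriving symbol, before the next symbol arrives, the algorithm must output the Hamming distance (number of mismatching positions) between $F$ and the last $n$ symbols of the stream. Cell-probe model: memory consists of cells of $w$ bits each (with $w$ at least of order $\log n$ so a cell can hold any address); computation is free and the cost (time) is the number of cells read or written. *)

theory Defs
  imports "HOL-Probability.Probability"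
begin

text \<open>
  The computation triggered by one arriving symbol is a decision tree. Computation between probes is
  free, so a continuation may be any function of the contents read. A tree is well-founded, so every
  computation makes finitely many probes.
\<close>

datatype program =
    Return nat
  | Read nat "nat \<Rightarrow> program"
  | Write nat nat program

type_synonym memory = "nat \<Rightarrow> nat"

text \<open>Addresses and cell contents are both \<open>w\<close>-bit values: a cell can hold any address.\<close>

primrec wf_program :: "nat \<Rightarrow> program \<Rightarrow> bool" where
  "wf_program w (Return r) \<longleftrightarrow> True"
| "wf_program w (Read a k) \<longleftrightarrow> a < 2 ^ w \<and> (\<forall>v<2 ^ w. wf_program w (k v))"
| "wf_program w (Write a v p) \<longleftrightarrow> a < 2 ^ w \<and> v < 2 ^ w \<and> wf_program w p"

primrec result_of :: "program \<Rightarrow> memory \<Rightarrow> nat" where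
  "result_of (Return r) M = r"
| "result_of (Read a k) M = result_of (k (M a)) M"
| "result_of (Write a v p) M = result_of p (M(a := v))"

primrec memory_of :: "program \<Rightarrow> memory \<Rightarrow> memory" where
  "memory_of (Return r) M = M"
| "memory_of (Read a k) M = memory_of (k (M a)) M"
| "memory_of (Write a v p) M = memory_of p (M(a := v))"

primrec probes_of :: "program \<Rightarrow> memory \<Rightarrow> nat" where
  "probes_of (Return r) M = 0"
| "probes_of (Read a k) M = Suc (probes_of (k (M a)) M)"
| "probes_of (Write a v p) M = Suc (probes_of p (M(a := v)))"

text \<open>
  A deterministic algorithm. The initial memory is the outcome of free preprocessing; the cells are
  the only state kept from one arrival to the next. The program run on an arrival depends on the
  symbol and on the arrival's index. The index is there so that probability distributions over
  deterministic algorithms include algorithms that toss fresh coins at every arrival.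
\<close>

record algorithm =
  initial :: memory
  program_at :: "nat \<Rightarrow> nat \<Rightarrow> program"

definition cell_probe_algorithm :: "nat \<Rightarrow> nat \<Rightarrow> algorithm \<Rightarrow> bool" where
  "cell_probe_algorithm w q A \<longleftrightarrow>
     (\<forall>a<2 ^ w. initial A a < 2 ^ w) \<and> (\<forall>t. \<forall>x<q. wf_program w (program_at A t x))"

primrec memory_before :: "algorithm \<Rightarrow> nat list \<Rightarrow> nat \<Rightarrow> memory" where
  "memory_before A xs 0 = initial A"
| "memory_before A xs (Suc t) = memory_of (program_at A t (xs ! t)) (memory_before A xs t)"

definition answer :: "algorithm \<Rightarrow> nat list \<Rightarrow> nat \<Rightarrow> nat" where
  "answer A xs t = result_of (program_at A t (xs ! t)) (memory_before A xs t)"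

definition total_probes :: "algorithm \<Rightarrow> nat list \<Rightarrow> nat" where
  "total_probes A xs =
     (\<Sum>t<length xs. probes_of (program_at A t (xs ! t)) (memory_before A xs t))"

definition strings :: "nat \<Rightarrow> nat \<Rightarrow> nat list set" where
  "strings q n = {xs. length xs = n \<and> set xs \<subseteq> {..<q}}"

definition hamming_distance :: "'a list \<Rightarrow> 'a list \<Rightarrow> nat" where
  "hamming_distance xs ys = card {i. i < length xs \<and> xs ! i \<noteq> ys ! i}"

definition last_symbols :: "nat \<Rightarrow> 'a list \<Rightarrow> 'a list" where
  "last_symbols n xs = drop (length xs - n) xs"

text \<open>While fewer than \<open>length F\<close> symbols have arrived, the output is unconstrained.\<close>

definition solves_online_hamming :: "nat \<Rightarrow> nat list \<Rightarrow> algorithm \<Rightarrow> bool" where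
  "solves_online_hamming q F A \<longleftrightarrow>
     (\<forall>m. \<forall>xs\<in>strings q m. \<forall>t<m. length F \<le> Suc t \<longrightarrow>
        answer A xs t = hamming_distance F (last_symbols (length F) (take (Suc t) xs)))"

text \<open>
  A randomised algorithm is a probability distribution over deterministic algorithms, on any
  sigma-algebra that makes the running time on each stream a random variable. It solves the problem
  if it is correct with probability 1.
\<close>

definition randomised_algorithm :: "nat \<Rightarrow> nat \<Rightarrow> algorithm measure \<Rightarrow> bool" where
  "randomised_algorithm w q R \<longleftrightarrow>
     prob_space R \<and>
     (\<forall>A\<in>space R. cell_probe_algorithm w q A) \<and>
     (\<forall>m. \<forall>xs\<in>strings q m. (\<lambda>A. total_probes A xs) \<in> measurable R (count_space UNIV))"

definition randomised_solves_online_hamming ::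
  "nat \<Rightarrow> nat \<Rightarrow> nat list \<Rightarrow> algorithm measure \<Rightarrow> bool" where
  "randomised_solves_online_hamming w q F R \<longleftrightarrow>
     randomised_algorithm w q R \<and> (AE A in R. solves_online_hamming q F A)"

definition expected_amortised_time :: "algorithm measure \<Rightarrow> nat list \<Rightarrow> ennreal" where
  "expected_amortised_time R xs =
     (\<integral>\<^sup>+ A. of_nat (total_probes A xs) \<partial>R) / of_nat (length xs)"

definition delta :: "nat \<Rightarrow> nat \<Rightarrow> int" where
  "delta q n = \<lceil>min (log 2 (real q)) (log 2 (real n))\<rceil>"

end

(*
  Information transfer. Cut the stream into intervals of length h, for every h of a geometric
  progression, and pair consecutive ones. If all symbols outside the first interval of a pair are
  fixed, the answers during the second interval depend only on the contents of the cells that are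
  read there and were last written during the first interval. So if the answers determine the
  symbols of the first interval, then on average order (entropy / w) reads are of this kind. Every
  read is charged to at most one pair, and so the bounds for the order log n scales h add up.

  It remains to find a fixed string whose answers determine a random interval of entropy of order
  delta * h, simultaneously at all scales. For bounded delta a binary string that changes its symbol
  at the powers of two will do. In general, symbols carry their position modulo c, for a small power
  c of min(q, n). This makes every answer the number of agreements of one block of c stream
  symbols with one of c designed queries, each block meeting each query. Finding blocks that are
  determined by these c numbers is a coin weighing problem: blocks are made of permutations, and
  the queries for a value weigh the bits of its positions with a Cantor-Mills matrix.
*)

theory Submission
  imports Defs
begin

section \<open>Cell-probe runs and information transfer\<close>

text \<open>The factor delta is the hard part. An answer that tests a single symbol yields one bit,
  however large the alphabet. To gain order delta bits, an answer has to be a count over many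
  unknowns, and the counts together must still determine every unknown; hence weighings.
  Permutations serve because each value occurs exactly once in each of them: a query for one value
  then collects one term per permutation, and this term can be any predicate of the unknown
  position. All values are queried in turn, so the permutations are recovered through their
  inverses.

  One string has to serve all scales at once. For large alphabets, the free symbols of a pair have
  ages within a factor of four during the second interval. Parts of the string that sit at powers of
  four therefore do not disturb one another. Only every second scale is then used, at the cost of a
  constant factor.\<close>

primrec cells_written :: "program \<Rightarrow> memory \<Rightarrow> nat set" where
  "cells_written (Return r) M = {}"
| "cells_written (Read a k) M = cells_written (k (M a)) M"
| "cells_written (Write a v p) M = insert a (cells_written p (M(a := v)))"

text \<open>Only cells that are read before the program itself overwrites them.\<close>

primrec cells_read :: "program \<Rightarrow> memory \<Rightarrow> nat set" where
  "cells_read (Return r) M = {}"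
| "cells_read (Read a k) M = insert a (cells_read (k (M a)) M)"
| "cells_read (Write a v p) M = cells_read p (M(a := v)) - {a}"

lemma memory_of_unwritten: "a \<notin> cells_written p M \<Longrightarrow> memory_of p M a = M a"
  by (induction p arbitrary: M) auto

text \<open>\<open>X\<close> has to vary in the induction: a write makes its cell known even if it
  was not before. The second claim returns the enlarged set, so that runs can be chained arrival by
  arrival.\<close>

lemma program_cong:
  assumes "\<forall>c\<in>X. M' c = M c" "cells_read p M \<subseteq> X"
  shows "result_of p M' = result_of p M"
    and "\<forall>c\<in>X \<union> cells_written p M. memory_of p M' c = memory_of p M c"
  using assms
proof (induction p arbitrary: M M' X)
  case (Write a v p)
  {
    case 1
    then have "\<forall>c\<in>insert a X. (M'(a := v)) c = (M(a := v)) c" "cells_read p (M(a := v)) \<subseteq> insert a X"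
      by auto
    from Write.IH(1)[OF this] show ?case by (simp add: fun_upd_def)
  next
    case 2
    then have "\<forall>c\<in>insert a X. (M'(a := v)) c = (M(a := v)) c" "cells_read p (M(a := v)) \<subseteq> insert a X"
      by auto
    from Write.IH(2)[OF this] show ?case by (simp add: fun_upd_def)
  }
qed auto

lemma finite_cells_read: "finite (cells_read p M)"
  by (induction p arbitrary: M) auto

lemma card_cells_read: "card (cells_read p M) \<le> probes_of p M"
proof (induction p arbitrary: M)
  case (Read a k)
  have "card (cells_read (Read a k) M) \<le> Suc (card (cells_read (k (M a)) M))"
    by (simp add: card_insert_le_m1 card_insert_if finite_cells_read)
  also have "\<dots> \<le> Suc (probes_of (k (M a)) M)"
    using Read.IH[of "k (M a)" M] by simp
  finally show ?case by simp
next
  case (Write a v p)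
  have "card (cells_read (Write a v p) M) \<le> card (cells_read p (M(a := v)))"
    by (simp add: card_Diff1_le)
  also have "\<dots> \<le> probes_of p (M(a := v))" by (rule Write.IH)
  finally show ?case by simp
qed simp

lemma wf_program_cells:
  assumes "wf_program w p" "\<forall>a<2 ^ w. M a < 2 ^ w"
  shows "cells_read p M \<subseteq> {..<2 ^ w}" and "\<forall>a<2 ^ w. memory_of p M a < 2 ^ w"
  using assms
proof (induction p arbitrary: M)
  case (Write a v p)
  {
    case 1
    then have "wf_program w p" "\<forall>a'<2 ^ w. (M(a := v)) a' < 2 ^ w" by auto
    from Write.IH(1)[OF this] show ?case by (auto simp: fun_upd_def)
  next
    case 2
    then have "wf_program w p" "\<forall>a'<2 ^ w. (M(a := v)) a' < 2 ^ w" by auto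
    from Write.IH(2)[OF this] show ?case by (auto simp: fun_upd_def)
  }
qed auto

section \<open>Information transfer between two adjacent intervals\<close>

definition reads_at :: "algorithm \<Rightarrow> nat list \<Rightarrow> nat \<Rightarrow> nat set" where
  "reads_at A xs t = cells_read (program_at A t (xs ! t)) (memory_before A xs t)"

definition writes_at :: "algorithm \<Rightarrow> nat list \<Rightarrow> nat \<Rightarrow> nat set" where
  "writes_at A xs t = cells_written (program_at A t (xs ! t)) (memory_before A xs t)"

definition transfer :: "algorithm \<Rightarrow> nat list \<Rightarrow> nat \<Rightarrow> nat \<Rightarrow> nat \<Rightarrow> (nat \<times> nat) set" where
  "transfer A xs a b e =
     {(t, c). t \<in> {b..<e} \<and> c \<in> reads_at A xs t \<and>
        (\<forall>s\<in>{b..<t}. c \<notin> writes_at A xs s) \<and> (\<exists>s\<in>{a..<b}. c \<in> writes_at A xs s)}"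

text \<open>No time is recorded: such a cell still holds at its read what it held at time
  \<open>b\<close>. So address and content, \<open>2 * w\<close> bits, suffice for a replay, and
  repeated reads of a cell are merged.\<close>

definition transfer_code :: "algorithm \<Rightarrow> nat list \<Rightarrow> nat \<Rightarrow> nat \<Rightarrow> nat \<Rightarrow> (nat \<times> nat) set" where
  "transfer_code A xs a b e = (\<lambda>(t, c). (c, memory_before A xs b c)) ` transfer A xs a b e"

primrec run_from :: "algorithm \<Rightarrow> nat list \<Rightarrow> nat \<Rightarrow> memory \<Rightarrow> nat \<Rightarrow> memory" where
  "run_from A xs b M 0 = M"
| "run_from A xs b M (Suc k) = memory_of (program_at A (b + k) (xs ! (b + k))) (run_from A xs b M k)"

lemma run_from_cong:
  assumes "\<forall>t\<in>{b..<b + k}. xs ! t = ys ! t"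
  shows "run_from A xs b M k = run_from A ys b M k"
  using assms by (induction k) auto

lemma memory_before_cong:
  assumes "\<forall>t<a. xs ! t = ys ! t"
  shows "memory_before A xs a = memory_before A ys a"
  using assms by (induction a) auto

lemma memory_before_unwritten:
  assumes "a \<le> b" "\<forall>s\<in>{a..<b}. c \<notin> writes_at A xs s"
  shows "memory_before A xs b c = memory_before A xs a c"
  using assms
proof (induction b)
  case (Suc b)
  then show ?case
    by (cases "a = Suc b") (auto simp: writes_at_def memory_of_unwritten)
qed auto

text \<open>The replay may differ from the true memory elsewhere. \<open>X\<close> contains the
  cells that are read before being written again since \<open>b\<close>, so every cell that is read
  lies in \<open>X\<close> or was rewritten by the replay itself.\<close>

lemma run_from_agree:
  assumes V: "\<forall>c\<in>X. V c = memory_before A xs b c"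
    and X: "\<And>t c. t \<in> {b..<e} \<Longrightarrow> c \<in> reads_at A xs t \<Longrightarrow>
              \<forall>s\<in>{b..<t}. c \<notin> writes_at A xs s \<Longrightarrow> c \<in> X"
  shows "b + k \<le> e \<Longrightarrow>
    \<forall>c\<in>X \<union> (\<Union>s\<in>{b..<b + k}. writes_at A xs s). run_from A xs b V k c = memory_before A xs (b + k) c"
proof (induction k)
  case 0
  then show ?case using V by simp
next
  case (Suc k)
  let ?X = "X \<union> (\<Union>s\<in>{b..<b + k}. writes_at A xs s)"
  let ?p = "program_at A (b + k) (xs ! (b + k))"
  have "cells_read ?p (memory_before A xs (b + k)) \<subseteq> ?X"
    using X[of "b + k"] Suc.prems by (auto simp: reads_at_def)
  from program_cong(2)[OF _ this, of "run_from A xs b V k"] Suc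
  have "\<forall>c\<in>?X \<union> writes_at A xs (b + k).
      run_from A xs b V (Suc k) c = memory_before A xs (b + Suc k) c"
    by (simp add: writes_at_def)
  moreover have "X \<union> (\<Union>s\<in>{b..<b + Suc k}. writes_at A xs s) = ?X \<union> writes_at A xs (b + k)"
    by (auto simp: less_Suc_eq)
  ultimately show ?case by simp
qed

lemma answer_run_from:
  assumes V: "\<forall>c\<in>X. V c = memory_before A xs b c"
    and X: "\<And>t c. t \<in> {b..<e} \<Longrightarrow> c \<in> reads_at A xs t \<Longrightarrow>
              \<forall>s\<in>{b..<t}. c \<notin> writes_at A xs s \<Longrightarrow> c \<in> X"
    and k: "b + k < e"
  shows "answer A xs (b + k) = result_of (program_at A (b + k) (xs ! (b + k))) (run_from A xs b V k)"
proof -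
  let ?X = "X \<union> (\<Union>s\<in>{b..<b + k}. writes_at A xs s)"
  have "cells_read (program_at A (b + k) (xs ! (b + k))) (memory_before A xs (b + k)) \<subseteq> ?X"
    using X[of "b + k"] k by (auto simp: reads_at_def)
  moreover have "\<forall>c\<in>?X. run_from A xs b V k c = memory_before A xs (b + k) c"
    by (rule run_from_agree[OF V X]) (use k in auto)
  ultimately show ?thesis
    unfolding answer_def by (rule program_cong(1)[symmetric, rotated])
qed

definition virtual_memory :: "(nat \<times> nat) set \<Rightarrow> memory \<Rightarrow> memory" where
  "virtual_memory W M c = (if \<exists>v. (c, v) \<in> W then THE v. (c, v) \<in> W else M c)"

text \<open>A cell that is read before it is rewritten, and that the code does not list, was not
  written in the first interval either. It still has its content of time \<open>a\<close>, and that
  memory is common to all streams with the same past.\<close>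

lemma virtual_memory_transfer_code:
  assumes "a \<le> b" "t \<in> {b..<e}" "c \<in> reads_at A xs t" "\<forall>s\<in>{b..<t}. c \<notin> writes_at A xs s"
  shows "virtual_memory (transfer_code A xs a b e) (memory_before A xs a) c = memory_before A xs b c"
proof (cases "\<exists>s\<in>{a..<b}. c \<in> writes_at A xs s")
  case True
  with assms have "(c, memory_before A xs b c) \<in> transfer_code A xs a b e"
    by (force simp: transfer_code_def transfer_def image_iff)
  moreover have "v = memory_before A xs b c" if "(c, v) \<in> transfer_code A xs a b e" for v
    using that by (auto simp: transfer_code_def)
  ultimately have "(THE v. (c, v) \<in> transfer_code A xs a b e) = memory_before A xs b c"
    by (intro the_equality)
  with \<open>(c, _) \<in> _\<close> show ?thesis
    unfolding virtual_memory_def by (simp only: if_P[OF exI])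
next
  case False
  then have "\<nexists>v. (c, v) \<in> transfer_code A xs a b e"
    by (auto simp: transfer_code_def transfer_def)
  then show ?thesis
    using memory_before_unwritten[OF assms(1), of c A xs] False by (simp add: virtual_memory_def)
qed

text \<open>
  Both runs are compared with the run that starts at time \<open>b\<close> from the memory rebuilt from the code.
\<close>

lemma answer_eq_if_transfer_code_eq:
  assumes "a \<le> b"
    and agree: "\<And>t. t < e \<Longrightarrow> t \<notin> {a..<b} \<Longrightarrow> xs ! t = ys ! t"
    and code: "transfer_code A xs a b e = transfer_code A ys a b e"
    and t: "t \<in> {b..<e}"
  shows "answer A xs t = answer A ys t"
proof -
  define V where "V = virtual_memory (transfer_code A xs a b e) (memory_before A xs a)"
  have before: "memory_before A xs a = memory_before A ys a"
    using agree assms(1) t by (intro memory_before_cong) auto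
  have run: "answer A zs t = result_of (program_at A t (zs ! t)) (run_from A zs b V (t - b))"
    if V: "V = virtual_memory (transfer_code A zs a b e) (memory_before A zs a)" for zs
  proof -
    let ?X = "{c. \<exists>t\<in>{b..<e}. c \<in> reads_at A zs t \<and> (\<forall>s\<in>{b..<t}. c \<notin> writes_at A zs s)}"
    have "\<forall>c\<in>?X. V c = memory_before A zs b c"
      unfolding V using virtual_memory_transfer_code[OF assms(1)] by auto
    then have "answer A zs (b + (t - b)) =
        result_of (program_at A (b + (t - b)) (zs ! (b + (t - b)))) (run_from A zs b V (t - b))"
      by (rule answer_run_from[where e = e]) (use t in auto)
    with t show ?thesis by simp
  qed
  have "run_from A xs b V (t - b) = run_from A ys b V (t - b)"
    using agree t by (intro run_from_cong) auto
  moreover have "xs ! t = ys ! t" using agree t by auto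
  ultimately show ?thesis
    using run[of xs] run[of ys] V_def code before by simp
qed

lemma memory_before_bound:
  assumes "cell_probe_algorithm w q A" "set xs \<subseteq> {..<q}" "t \<le> length xs" "a < 2 ^ w"
  shows "memory_before A xs t a < 2 ^ w"
  using assms(3,4)
proof (induction t arbitrary: a)
  case 0
  then show ?case using assms(1) by (simp add: cell_probe_algorithm_def)
next
  case (Suc t)
  have "xs ! t < q" using assms(2) Suc.prems nth_mem[of t xs] by (meson Suc_le_eq lessThan_iff subsetD)
  then have "wf_program w (program_at A t (xs ! t))"
    using assms(1) by (simp add: cell_probe_algorithm_def)
  from wf_program_cells(2)[OF this] Suc show ?case by auto
qed

lemma reads_at_bound:
  assumes "cell_probe_algorithm w q A" "set xs \<subseteq> {..<q}" "t < length xs"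
  shows "reads_at A xs t \<subseteq> {..<2 ^ w}"
proof -
  have "xs ! t < q" using assms(2,3) nth_mem[of t xs] by (meson lessThan_iff subsetD)
  then have "wf_program w (program_at A t (xs ! t))"
    using assms(1) by (simp add: cell_probe_algorithm_def)
  from wf_program_cells(1)[OF this] memory_before_bound[OF assms(1,2)] assms(3)
  show ?thesis by (simp add: reads_at_def)
qed

lemma finite_transfer: "finite (transfer A xs a b e)"
proof (rule finite_subset)
  show "transfer A xs a b e \<subseteq> Sigma {b..<e} (reads_at A xs)"
    by (auto simp: transfer_def)
qed (auto simp: reads_at_def finite_cells_read)

lemma transfer_code_bound:
  assumes "cell_probe_algorithm w q A" "xs \<in> strings q m" "b \<le> e" "e \<le> m"
  shows "transfer_code A xs a b e \<subseteq> {..<2 ^ w} \<times> {..<2 ^ w}"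
proof -
  have xs: "set xs \<subseteq> {..<q}" "length xs = m" using assms(2) by (auto simp: strings_def)
  have "c < 2 ^ w" "memory_before A xs b c < 2 ^ w" if "(t, c) \<in> transfer A xs a b e" for t c
  proof -
    show "c < 2 ^ w"
      using that reads_at_bound[OF assms(1) xs(1), of t] assms(4) xs(2) by (auto simp: transfer_def)
    then show "memory_before A xs b c < 2 ^ w"
      using memory_before_bound[OF assms(1) xs(1)] assms(3,4) xs(2) by simp
  qed
  then show ?thesis by (auto simp: transfer_code_def)
qed

lemma card_transfer_code: "card (transfer_code A xs a b e) \<le> card (transfer A xs a b e)"
  unfolding transfer_code_def by (rule card_image_le[OF finite_transfer])

text \<open>Each exposed read is charged to the unique node separating it from the last write to its cell.\<close>

lemma sum_card_transfer_le_total_probes: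
  assumes "finite V"
    and e: "\<And>v. v \<in> V \<Longrightarrow> e v \<le> length xs"
    and unique: "\<And>v v' s t. v \<in> V \<Longrightarrow> v' \<in> V \<Longrightarrow>
       s \<in> {a v..<b v} \<Longrightarrow> t \<in> {b v..<e v} \<Longrightarrow> s \<in> {a v'..<b v'} \<Longrightarrow> t \<in> {b v'..<e v'} \<Longrightarrow> v = v'"
  shows "(\<Sum>v\<in>V. card (transfer A xs (a v) (b v) (e v))) \<le> total_probes A xs"
proof -
  let ?T = "\<lambda>v. transfer A xs (a v) (b v) (e v)"
  have last: "Max {s. s < t \<and> c \<in> writes_at A xs s} \<in> {a v..<b v} \<and> t \<in> {b v..<e v}"
    if "(t, c) \<in> ?T v" for t c v
  proof -
    let ?W = "{s. s < t \<and> c \<in> writes_at A xs s}"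
    from that obtain s where s: "s \<in> {a v..<b v}" "c \<in> writes_at A xs s" and t: "t \<in> {b v..<e v}"
      and nw: "\<forall>s\<in>{b v..<t}. c \<notin> writes_at A xs s"
      by (auto simp: transfer_def)
    have "s \<in> ?W" using s t by auto
    then have "Max ?W \<in> ?W" by (intro Max_in) auto
    have "s \<le> Max ?W" using \<open>s \<in> ?W\<close> by (intro Max_ge) auto
    have "Max ?W < b v"
      using \<open>Max ?W \<in> ?W\<close> nw by (metis (mono_tags, lifting) atLeastLessThan_iff leI mem_Collect_eq)
    then show ?thesis using s \<open>s \<le> Max ?W\<close> t by auto
  qed
  have disj: "?T v \<inter> ?T v' = {}" if "v \<in> V" "v' \<in> V" "v \<noteq> v'" for v v'
  proof (rule ccontr)
    assume "?T v \<inter> ?T v' \<noteq> {}"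
    then obtain t c where "(t, c) \<in> ?T v" "(t, c) \<in> ?T v'" by auto
    from last[OF this(1)] last[OF this(2)] unique[OF that(1,2)] that(3) show False by blast
  qed
  have "(\<Sum>v\<in>V. card (?T v)) = card (\<Union>v\<in>V. ?T v)"
    using disj by (intro card_UN_disjoint[symmetric] assms(1)) (auto simp: finite_transfer)
  also have "\<dots> \<le> card (Sigma {..<length xs} (reads_at A xs))"
    using e by (intro card_mono) (force simp: transfer_def reads_at_def finite_cells_read)+
  also have "\<dots> = (\<Sum>t<length xs. card (reads_at A xs t))"
    by (intro card_SigmaI) (auto simp: reads_at_def finite_cells_read)
  also have "\<dots> \<le> total_probes A xs"
    unfolding total_probes_def reads_at_def by (intro sum_mono card_cells_read)
  finally show ?thesis .
qed

section \<open>Counting\<close>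

lemma card_subsets_card_le:
  assumes "finite X"
  shows "card {S. S \<subseteq> X \<and> card S \<le> k} \<le> (card X + 1) ^ k"
proof (induction k)
  case 0
  have "{S. S \<subseteq> X \<and> card S \<le> 0} \<subseteq> {{}}"
    using assms by (auto simp: finite_subset)
  then have "card {S. S \<subseteq> X \<and> card S \<le> 0} \<le> card {{} :: 'a set}"
    by (intro card_mono) auto
  then show ?case by simp
next
  case (Suc k)
  let ?F = "\<lambda>k. {S. S \<subseteq> X \<and> card S \<le> k}"
  have fin: "finite (?F k)" for k using assms by simp
  have "?F (Suc k) \<subseteq> ?F k \<union> (\<lambda>(x, S). insert x S) ` (X \<times> ?F k)"
  proof
    fix S assume S: "S \<in> ?F (Suc k)"
    show "S \<in> ?F k \<union> (\<lambda>(x, S). insert x S) ` (X \<times> ?F k)"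
    proof (cases "S = {}")
      case False
      then obtain x where "x \<in> S" by auto
      moreover have "finite S" using S assms finite_subset by auto
      ultimately have "S = insert x (S - {x})" "(x, S - {x}) \<in> X \<times> ?F k" using S by auto
      then show ?thesis by (intro UnI2 image_eqI[of _ _ "(x, S - {x})"]) simp_all
    qed simp
  qed
  then have "card (?F (Suc k)) \<le> card (?F k \<union> (\<lambda>(x, S). insert x S) ` (X \<times> ?F k))"
    using fin assms by (intro card_mono) auto
  also have "\<dots> \<le> card (?F k) + card ((\<lambda>(x, S). insert x S) ` (X \<times> ?F k))"
    by (rule card_Un_le)
  also have "\<dots> \<le> card (?F k) + card X * card (?F k)"
    using card_image_le[of "X \<times> ?F k" "\<lambda>(x, S). insert x S"] fin assms
    by (simp add: card_cartesian_product)
  also have "\<dots> \<le> (card X + 1) ^ Suc k"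
    using Suc.IH by (simp add: algebra_simps add_mono mult_le_mono)
  finally show ?case .
qed

text \<open>An elementary substitute for an entropy bound. If \<open>k\<close> is maximal with
  \<open>2 ^ (3 * w * k + 1) \<le> card E\<close>, at most half of \<open>E\<close> can have codes
  of at most \<open>k\<close> pairs; each element of the other half pays at least
  \<open>Suc k\<close>, which is at least \<open>log 2 (card E) / (4 * w)\<close>.\<close>

lemma sum_card_inj_codes_ge:
  fixes f :: "'a \<Rightarrow> (nat \<times> nat) set"
  assumes "finite E" "w \<ge> 1" and f: "\<And>x. x \<in> E \<Longrightarrow> f x \<subseteq> {..<2 ^ w} \<times> {..<2 ^ w}"
    and inj: "inj_on f E"
  shows "real (card E) * (log 2 (card E) / (8 * w)) \<le> (\<Sum>x\<in>E. real (card (f x)))"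
proof (cases "card E \<le> 1")
  case True
  then have "real (card E) * (log 2 (card E) / (8 * w)) = 0"
    by (cases "card E = 0") (simp_all add: le_Suc_eq)
  then show ?thesis by (metis of_nat_0_le_iff sum_nonneg)
next
  case False
  define n where "n = card E"
  \<comment> \<open>A pair takes \<open>2 * w\<close> bits; the exponent \<open>3 * w\<close>
    absorbs the \<open>+ 1\<close> of \<open>card_subsets_card_le\<close>, and the last
    \<open>+ 1\<close> leaves half of \<open>E\<close> over.\<close>
  let ?P = "\<lambda>k. 2 ^ (3 * w * k + 1) \<le> n"
  have P0: "?P 0" using False by (simp add: n_def)
  have bound: "k \<le> n" if "?P k" for k
  proof -
    have "1 * k \<le> w * k" using assms(2) by (rule mult_le_mono1)
    then have "k \<le> 3 * w * k + 1" by linarith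
    have "k < 2 ^ k" by (rule less_exp)
    also have "\<dots> \<le> 2 ^ (3 * w * k + 1)" by (rule power_increasing) (use \<open>k \<le> _\<close> in simp_all)
    finally show ?thesis using that by simp
  qed
  define k where "k = Greatest ?P"
  have Pk: "?P k" unfolding k_def using P0 bound by (rule GreatestI_nat)
  have "\<not> ?P (Suc k)"
  proof
    assume "?P (Suc k)"
    then have "Suc k \<le> k" unfolding k_def using bound by (rule Greatest_le_nat)
    then show False by simp
  qed
  moreover define l where "l = 3 * w * Suc k + 1"
  ultimately have "n < 2 ^ l" by simp
  then have "real n < real (2 ^ l)" by (rule of_nat_less_iff[THEN iffD2])
  then have "log 2 n < l"
    using P0 by (subst log_less_iff) (auto simp: powr_realpow)
  moreover have "l \<le> 4 * (w * Suc k)"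
    using mult_le_mono[OF assms(2), of 1 "Suc k"] unfolding l_def by linarith
  then have "real l \<le> 4 * (real w * Suc k)" by (metis of_nat_le_iff of_nat_mult of_nat_numeral)
  ultimately have log: "log 2 n \<le> 4 * (real w * Suc k)" by simp
  let ?S = "{x \<in> E. card (f x) \<le> k}"
  have "card ?S = card (f ` ?S)"
    by (rule card_image[symmetric]) (use inj in \<open>auto intro: inj_on_subset\<close>)
  also have "\<dots> \<le> card {S. S \<subseteq> {..<2 ^ w :: nat} \<times> {..<2 ^ w :: nat} \<and> card S \<le> k}"
    using f by (intro card_mono) auto
  also have "\<dots> \<le> (card ({..<2 ^ w :: nat} \<times> {..<2 ^ w :: nat}) + 1) ^ k"
    by (intro card_subsets_card_le) auto
  also have "\<dots> \<le> (2 ^ (3 * w)) ^ k"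
  proof (intro power_mono)
    have "(1::nat) \<le> 2 ^ (2 * w)" by simp
    then have "(2::nat) ^ (2 * w) + 1 \<le> 2 * 2 ^ (2 * w)" by linarith
    also have "\<dots> = 2 ^ (2 * w + 1)" by simp
    also have "\<dots> \<le> 2 ^ (3 * w)" using assms(2) by (intro power_increasing) auto
    finally show "card ({..<2 ^ w :: nat} \<times> {..<2 ^ w :: nat}) + 1 \<le> 2 ^ (3 * w)"
      by (simp add: card_cartesian_product power_add[symmetric] mult_2)
  qed simp
  finally have "2 * card ?S \<le> n" using Pk by (simp add: power_mult)
  moreover have "card (E - ?S) = n - card ?S"
    unfolding n_def by (rule card_Diff_subset) (use assms(1) in auto)
  ultimately have half: "real n \<le> 2 * card (E - ?S)" by linarith
  have "real n * log 2 n \<le> (2 * card (E - ?S)) * (4 * (real w * Suc k))"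
    using half log P0 by (intro mult_mono) auto
  also have "\<dots> = 8 * w * (\<Sum>x\<in>E - ?S. real (Suc k))" by simp
  also have "\<dots> \<le> 8 * w * (\<Sum>x\<in>E - ?S. real (card (f x)))"
    by (intro mult_left_mono sum_mono) auto
  also have "\<dots> \<le> 8 * w * (\<Sum>x\<in>E. real (card (f x)))"
    using assms(1) by (intro mult_left_mono sum_mono2) auto
  finally show ?thesis using assms(2) by (simp add: n_def field_simps)
qed

section \<open>Averaging over streams and over algorithms\<close>

lemma sum_card_transfer_ge:
  assumes A: "cell_probe_algorithm w q A" and "w \<ge> 1" "finite E" "a \<le> b" "b \<le> e" "e \<le> m"
    and xs: "\<And>\<omega>. \<omega> \<in> E \<Longrightarrow> xs \<omega> \<in> strings q m"
    and agree: "\<And>\<omega> \<omega>' t. \<omega> \<in> E \<Longrightarrow> \<omega>' \<in> E \<Longrightarrow> t < m \<Longrightarrow> t \<notin> {a..<b} \<Longrightarrow> xs \<omega> ! t = xs \<omega>' ! t"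
    and inj: "\<And>\<omega> \<omega>'. \<omega> \<in> E \<Longrightarrow> \<omega>' \<in> E \<Longrightarrow>
      (\<forall>t\<in>{b..<e}. answer A (xs \<omega>) t = answer A (xs \<omega>') t) \<Longrightarrow> \<omega> = \<omega>'"
  shows "real (card E) * (log 2 (card E) / (8 * w)) \<le> (\<Sum>\<omega>\<in>E. real (card (transfer A (xs \<omega>) a b e)))"
proof -
  have "inj_on (\<lambda>\<omega>. transfer_code A (xs \<omega>) a b e) E"
  proof (rule inj_onI)
    fix \<omega> \<omega>' assume \<omega>: "\<omega> \<in> E" "\<omega>' \<in> E"
      and code: "transfer_code A (xs \<omega>) a b e = transfer_code A (xs \<omega>') a b e"
    have "answer A (xs \<omega>) t = answer A (xs \<omega>') t" if "t \<in> {b..<e}" for t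
      by (rule answer_eq_if_transfer_code_eq[OF assms(4) _ code that])
        (use agree[OF \<omega>] assms(6) in simp)
    with inj \<omega> show "\<omega> = \<omega>'" by blast
  qed
  then have "real (card E) * (log 2 (card E) / (8 * w)) \<le>
      (\<Sum>\<omega>\<in>E. real (card (transfer_code A (xs \<omega>) a b e)))"
    using transfer_code_bound[OF A xs assms(5,6)] assms(2,3) by (intro sum_card_inj_codes_ge) auto
  also have "\<dots> \<le> (\<Sum>\<omega>\<in>E. real (card (transfer A (xs \<omega>) a b e)))"
    by (intro sum_mono of_nat_mono card_transfer_code)
  finally show ?thesis .
qed

text \<open>Conditioning: \<open>r\<close> will forget the free blocks of one interval, and a fibre
  consists of the streams with a given remainder. A lower bound \<open>K\<close> on the fibre sizes
  is enough, since the bound per element grows with the size.\<close>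

lemma sum_fibres_ge:
  fixes g :: "'a \<Rightarrow> real"
  assumes "finite D" and K: "K \<ge> 1"
    and fibre: "\<And>y. y \<in> r ` D \<Longrightarrow> K \<le> real (card {x \<in> D. r x = y}) \<and>
       real (card {x \<in> D. r x = y}) * (log 2 (card {x \<in> D. r x = y}) * d) \<le> (\<Sum>x\<in>{x \<in> D. r x = y}. g x)"
    and "d \<ge> 0"
  shows "real (card D) * (log 2 K * d) \<le> sum g D"
proof -
  have "real (card D) * (log 2 K * d) = (\<Sum>x\<in>D. log 2 K * d)" by simp
  also have "\<dots> = (\<Sum>y\<in>r ` D. \<Sum>x\<in>{x \<in> D. r x = y}. log 2 K * d)"
    by (rule sum.image_gen[OF assms(1)])
  also have "\<dots> \<le> (\<Sum>y\<in>r ` D. \<Sum>x\<in>{x \<in> D. r x = y}. g x)"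
  proof (rule sum_mono)
    fix y assume "y \<in> r ` D"
    note f = fibre[OF this]
    have "(\<Sum>x\<in>{x \<in> D. r x = y}. log 2 K * d) = real (card {x \<in> D. r x = y}) * (log 2 K * d)" by simp
    also have "\<dots> \<le> real (card {x \<in> D. r x = y}) * (log 2 (card {x \<in> D. r x = y}) * d)"
      using f K assms(4) by (intro mult_left_mono mult_right_mono) auto
    also have "\<dots> \<le> (\<Sum>x\<in>{x \<in> D. r x = y}. g x)" using f by simp
    finally show "(\<Sum>x\<in>{x \<in> D. r x = y}. log 2 K * d) \<le> (\<Sum>x\<in>{x \<in> D. r x = y}. g x)" .
  qed
  also have "\<dots> = sum g D" by (rule sum.image_gen[OF assms(1), symmetric])
  finally show ?thesis .
qed

text \<open>The easy half of Yao's principle: the bound on the sum over \<open>D\<close> holds for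
  almost every algorithm, hence for the integral. After sum and integral are exchanged, some stream
  is at least as costly as the average.\<close>

lemma exists_expected_amortised_time_ge:
  fixes m :: nat and T :: real
  assumes R: "randomised_solves_online_hamming w q F R"
    and D: "finite D" "D \<noteq> {}" and xs: "\<And>\<omega>. \<omega> \<in> D \<Longrightarrow> xs \<omega> \<in> strings q m" and "m > 0"
    and bound: "\<And>A. cell_probe_algorithm w q A \<Longrightarrow> solves_online_hamming q F A \<Longrightarrow>
       real (card D) * (m * T) \<le> (\<Sum>\<omega>\<in>D. real (total_probes A (xs \<omega>)))"
  shows "\<exists>\<omega>\<in>D. ennreal T \<le> expected_amortised_time R (xs \<omega>)"
proof -
  interpret prob_space R
    using R by (simp add: randomised_solves_online_hamming_def randomised_algorithm_def)
  let ?f = "\<lambda>\<omega> A. of_nat (total_probes A (xs \<omega>)) :: ennreal"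
  have meas: "?f \<omega> \<in> borel_measurable R" if "\<omega> \<in> D" for \<omega>
  proof -
    have "(\<lambda>A. total_probes A (xs \<omega>)) \<in> measurable R (count_space UNIV)"
      using R xs[OF that]
      by (auto simp: randomised_solves_online_hamming_def randomised_algorithm_def)
    then show ?thesis by measurable
  qed
  have ae: "AE A in R. ennreal (real (card D) * (m * T)) \<le> (\<Sum>\<omega>\<in>D. ?f \<omega> A)"
  proof -
    have "AE A in R. solves_online_hamming q F A"
      using R by (simp add: randomised_solves_online_hamming_def)
    then show ?thesis
    proof (rule AE_mp, intro AE_I2 impI)
      fix A assume "A \<in> space R" "solves_online_hamming q F A"
      moreover from this have "cell_probe_algorithm w q A"
        using R by (auto simp: randomised_solves_online_hamming_def randomised_algorithm_def)
      ultimately have "real (card D) * (m * T) \<le> (\<Sum>\<omega>\<in>D. real (total_probes A (xs \<omega>)))"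
        using bound by blast
      then have "ennreal (real (card D) * (m * T)) \<le> ennreal (\<Sum>\<omega>\<in>D. real (total_probes A (xs \<omega>)))"
        by (rule ennreal_leI)
      also have "\<dots> = (\<Sum>\<omega>\<in>D. ?f \<omega> A)"
        by (subst sum_ennreal[symmetric]) (auto simp: ennreal_of_nat_eq_real_of_nat)
      finally show "ennreal (real (card D) * (m * T)) \<le> (\<Sum>\<omega>\<in>D. ?f \<omega> A)" .
    qed
  qed
  have "ennreal (real (card D) * (m * T)) = (\<integral>\<^sup>+ A. ennreal (real (card D) * (m * T)) \<partial>R)"
    by (simp add: emeasure_space_1)
  also have "\<dots> \<le> (\<integral>\<^sup>+ A. (\<Sum>\<omega>\<in>D. ?f \<omega> A) \<partial>R)" by (rule nn_integral_mono_AE[OF ae])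
  also have "\<dots> = (\<Sum>\<omega>\<in>D. \<integral>\<^sup>+ A. ?f \<omega> A \<partial>R)" by (rule nn_integral_sum[OF meas])
  finally have total: "ennreal (real (card D) * (m * T)) \<le> (\<Sum>\<omega>\<in>D. \<integral>\<^sup>+ A. ?f \<omega> A \<partial>R)" .
  define I where "I \<omega> = (\<integral>\<^sup>+ A. ?f \<omega> A \<partial>R)" for \<omega>
  have "Max (I ` D) \<in> I ` D" using D by (intro Max_in) auto
  then obtain \<omega> where \<omega>: "\<omega> \<in> D" "Max (I ` D) = I \<omega>" by auto
  have "(\<Sum>\<omega>\<in>D. I \<omega>) \<le> of_nat (card D) * I \<omega>"
    using D \<omega>(2) by (intro sum_bounded_above) (metis Max_ge finite_imageI imageI)
  with total have le: "ennreal (real (card D) * (m * T)) \<le> of_nat (card D) * I \<omega>"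
    by (simp add: I_def)
  have cD: "card D > 0" using D by (simp add: card_gt_0_iff)
  have "ennreal T \<le> I \<omega> / of_nat m"
  proof (cases "T \<le> 0")
    case False
    have "of_nat (card D) * ennreal (m * T) \<le> of_nat (card D) * I \<omega>"
      using le False by (simp add: ennreal_mult ennreal_of_nat_eq_real_of_nat)
    then have "ennreal (m * T) \<le> I \<omega>"
      using cD by (simp add: ennreal_mult_le_mult_iff)
    then have "ennreal (m * T) / of_nat m \<le> I \<omega> / of_nat m" by (rule divide_right_mono_ennreal)
    moreover have "ennreal (m * T) / of_nat m = ennreal T"
      using assms(5) False by (simp add: ennreal_of_nat_eq_real_of_nat divide_ennreal)
    ultimately show ?thesis by simp
  qed (simp add: ennreal_neg)
  moreover have "length (xs \<omega>) = m" using xs[OF \<omega>(1)] by (simp add: strings_def)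
  ultimately have "ennreal T \<le> expected_amortised_time R (xs \<omega>)"
    by (simp add: expected_amortised_time_def I_def)
  with \<omega>(1) show ?thesis by blast
qed

section \<open>Streams of codewords\<close>

text \<open>\<open>G\<close> is indexed by age: at time \<open>t\<close> the symbol of time
  \<open>T\<close> has age \<open>t - T\<close>, and the last symbol of the string faces age 0. In
  this indexing \<open>n\<close> only limits the window, so one \<open>G\<close> can be analysed
  scale by scale.\<close>

lemma answer_eq_mismatches:
  assumes "solves_online_hamming q (map (\<lambda>i. G (n - 1 - i)) [0..<n]) A" "xs \<in> strings q m" "n \<le> Suc t" "t < m"
  shows "answer A xs t = card {T \<in> {Suc t - n..<Suc t}. xs ! T \<noteq> G (t - T)}"
proof -
  let ?F = "map (\<lambda>i. G (n - 1 - i)) [0..<n]" and ?L = "last_symbols n (take (Suc t) xs)"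
  have len: "length xs = m" using assms(2) by (simp add: strings_def)
  have "answer A xs t = hamming_distance ?F ?L"
    using assms unfolding solves_online_hamming_def by auto
  also have "\<dots> = card {i. i < n \<and> G (n - 1 - i) \<noteq> xs ! (Suc t - n + i)}"
  proof -
    have "length (take (Suc t) xs) = Suc t" using len assms(4) by simp
    then show ?thesis
      unfolding hamming_distance_def last_symbols_def using assms(3)
      by (intro arg_cong[where f = card] Collect_cong conj_cong) (auto simp del: length_take)
  qed
  also have "\<dots> = card {T \<in> {Suc t - n..<Suc t}. xs ! T \<noteq> G (t - T)}"
  proof (rule bij_betw_same_card[where f = "\<lambda>i. Suc t - n + i"],
      rule bij_betw_byWitness[where f' = "\<lambda>T. T - (Suc t - n)"])
    show "\<forall>i\<in>{i. i < n \<and> G (n - 1 - i) \<noteq> xs ! (Suc t - n + i)}. (Suc t - n + i) - (Suc t - n) = i"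
      by simp
    show "\<forall>T\<in>{T \<in> {Suc t - n..<Suc t}. xs ! T \<noteq> G (t - T)}. (Suc t - n) + (T - (Suc t - n)) = T"
      by auto
    show "(\<lambda>i. Suc t - n + i) ` {i. i < n \<and> G (n - 1 - i) \<noteq> xs ! (Suc t - n + i)}
        \<subseteq> {T \<in> {Suc t - n..<Suc t}. xs ! T \<noteq> G (t - T)}"
    proof safe
      fix i assume i: "i < n" "G (n - 1 - i) \<noteq> xs ! (Suc t - n + i)"
      have eq: "t - (Suc t - n + i) = n - 1 - i" using i assms(3) by linarith
      show "Suc t - n + i \<in> {Suc t - n..<Suc t}" using i assms(3) by auto
      assume "xs ! (Suc t - n + i) = G (t - (Suc t - n + i))"
      with i(2) eq show False by simp
    qed
    show "(\<lambda>T. T - (Suc t - n)) ` {T \<in> {Suc t - n..<Suc t}. xs ! T \<noteq> G (t - T)}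
        \<subseteq> {i. i < n \<and> G (n - 1 - i) \<noteq> xs ! (Suc t - n + i)}"
    proof safe
      fix T assume T: "T \<in> {Suc t - n..<Suc t}" "xs ! T \<noteq> G (t - T)"
      have eq: "n - 1 - (T - (Suc t - n)) = t - T" using T(1) assms(3) by auto
      have eq': "Suc t - n + (T - (Suc t - n)) = T" using T(1) by auto
      show "T - (Suc t - n) < n" using T(1) assms(3) by auto
      assume "G (n - 1 - (T - (Suc t - n))) = xs ! (Suc t - n + (T - (Suc t - n)))"
      with T(2) eq eq' show False by simp
    qed
  qed
  finally show ?thesis .
qed

text \<open>The interval lies inside the window of the last \<open>n\<close> symbols. Outside it
  both streams mismatch equally often, so equal answers leave equal counts inside.\<close>

lemma matches_eq_if_answer_eq:
  assumes A: "solves_online_hamming q (map (\<lambda>i. G (n - 1 - i)) [0..<n]) A"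
    and xs: "xs \<in> strings q m" and ys: "ys \<in> strings q m" and t: "n \<le> Suc t" "t < m"
    and ab: "Suc t \<le> a + n" "b \<le> Suc t"
    and agree: "\<And>T. T < m \<Longrightarrow> T \<notin> {a..<b} \<Longrightarrow> xs ! T = ys ! T"
    and eq: "answer A xs t = answer A ys t"
  shows "(\<Sum>T\<in>{a..<b}. of_bool (xs ! T = G (t - T)) :: nat) = (\<Sum>T\<in>{a..<b}. of_bool (ys ! T = G (t - T)))"
proof -
  let ?W = "{Suc t - n..<Suc t}"
  have split: "answer A zs t + (\<Sum>T\<in>{a..<b}. of_bool (zs ! T = G (t - T)))
      = (b - a) + card {T \<in> ?W - {a..<b}. zs ! T \<noteq> G (t - T)}"
    if zs: "zs \<in> strings q m" for zs
  proof -
    have "answer A zs t = card {T \<in> ?W. zs ! T \<noteq> G (t - T)}"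
      by (rule answer_eq_mismatches[OF A zs t])
    also have "{T \<in> ?W. zs ! T \<noteq> G (t - T)} =
        {T \<in> {a..<b}. zs ! T \<noteq> G (t - T)} \<union> {T \<in> ?W - {a..<b}. zs ! T \<noteq> G (t - T)}"
      using ab by auto
    also have "card \<dots> = card {T \<in> {a..<b}. zs ! T \<noteq> G (t - T)} + card {T \<in> ?W - {a..<b}. zs ! T \<noteq> G (t - T)}"
      by (rule card_Un_disjoint) auto
    finally have "answer A zs t = \<dots>" .
    moreover have "card {T \<in> {a..<b}. zs ! T \<noteq> G (t - T)} + card {T \<in> {a..<b}. zs ! T = G (t - T)}
        = card ({T \<in> {a..<b}. zs ! T \<noteq> G (t - T)} \<union> {T \<in> {a..<b}. zs ! T = G (t - T)})"
      by (rule card_Un_disjoint[symmetric]) auto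
    moreover have "{T \<in> {a..<b}. zs ! T \<noteq> G (t - T)} \<union> {T \<in> {a..<b}. zs ! T = G (t - T)} = {a..<b}"
      by auto
    moreover have "(\<Sum>T\<in>{a..<b}. of_bool (zs ! T = G (t - T)) :: nat) = card {T \<in> {a..<b}. zs ! T = G (t - T)}"
      by (simp add: sum.If_cases of_bool_def Int_def conj_commute)
    ultimately show ?thesis by simp
  qed
  have "{T \<in> ?W - {a..<b}. xs ! T \<noteq> G (t - T)} = {T \<in> ?W - {a..<b}. ys ! T \<noteq> G (t - T)}"
    using agree t by auto
  with split[OF xs] split[OF ys] eq show ?thesis by simp
qed

lemma sum_lessThan_times:
  "(\<Sum>i<j * c. f i) = (\<Sum>k<j. \<Sum>x<c. f (k * c + x :: nat) :: 'a::comm_monoid_add)"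
proof -
  have "(\<Sum>x<c. f (k * c + x)) = sum f {k * c..<k * c + c}" for k
    using sum.atLeastLessThan_shift_0[of f "k * c" "k * c + c"] by (simp add: atLeast0LessThan)
  then show ?thesis by (simp add: sum.nat_group)
qed

text \<open>
  A stream is made of codewords of length \<open>c\<close>, block \<open>k\<close> being the codeword \<open>emb (\<phi> k)\<close>; \<open>G\<close> is the
  fixed string read backwards, so that at time \<open>t\<close> the symbol of time \<open>T\<close> is compared with \<open>G (t - T)\<close>.
  The sums below count the matches of the first \<open>j\<close> blocks at a time \<open>t\<close>.
\<close>

definition decodable ::
  "(nat \<Rightarrow> nat) \<Rightarrow> nat \<Rightarrow> ('a \<Rightarrow> nat \<Rightarrow> nat) \<Rightarrow> 'a set \<Rightarrow> nat \<Rightarrow> nat \<Rightarrow> bool" where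
  "decodable G c emb B \<eta> j \<longleftrightarrow>
     (\<forall>\<phi> \<psi>. (\<forall>k<j. \<phi> k \<in> B \<and> \<psi> k \<in> B) \<longrightarrow>
        (\<forall>t\<in>{\<eta> * c..<2 * \<eta> * c}.
           (\<Sum>k<j. \<Sum>x<c. of_bool (emb (\<phi> k) x = G (t - (k * c + x))) :: nat) =
           (\<Sum>k<j. \<Sum>x<c. of_bool (emb (\<psi> k) x = G (t - (k * c + x))))) \<longrightarrow>
        (\<forall>k<j. \<phi> k = \<psi> k))"

text \<open>The \<open>n\<close> leading zeros move all random symbols to times at which the output
  is constrained; the trailing zeros replace an incomplete last block.\<close>

definition block_stream :: "nat \<Rightarrow> nat \<Rightarrow> nat \<Rightarrow> ('a \<Rightarrow> nat \<Rightarrow> nat) \<Rightarrow> (nat \<Rightarrow> 'a) \<Rightarrow> nat list" where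
  "block_stream n m c emb \<omega> = replicate n 0 @
     map (\<lambda>\<tau>. if \<tau> div c < (m - n) div c then emb (\<omega> (\<tau> div c)) (\<tau> mod c) else 0) [0..<m - n]"

lemma block_stream_nth:
  assumes "n \<le> t" "t < m"
  shows "block_stream n m c emb \<omega> ! t =
    (if (t - n) div c < (m - n) div c then emb (\<omega> ((t - n) div c)) ((t - n) mod c) else 0)"
  using assms by (simp add: block_stream_def nth_append)

lemma block_stream_strings:
  assumes "n \<le> m" "q \<ge> 1" "c \<ge> 1" "\<And>k. k < (m - n) div c \<Longrightarrow> \<omega> k \<in> B" "\<And>\<phi> x. \<phi> \<in> B \<Longrightarrow> x < c \<Longrightarrow> emb \<phi> x < q"
  shows "block_stream n m c emb \<omega> \<in> strings q m"
  using assms by (auto simp: strings_def block_stream_def)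

lemma block_node_transfer_ge:
  fixes n m q w c \<eta> j i :: nat
  assumes A: "cell_probe_algorithm w q A" "solves_online_hamming q (map (\<lambda>i. G (n - 1 - i)) [0..<n]) A"
    and "w \<ge> 1" "n \<ge> 1" "q \<ge> 1" "c \<ge> 1" "n \<le> m"
    and B: "finite B" "B \<noteq> {}" "\<And>\<phi> x. \<phi> \<in> B \<Longrightarrow> x < c \<Longrightarrow> emb \<phi> x < q"
    and \<eta>: "2 * (\<eta> * c) \<le> n" "2 * (\<eta> * c) * Suc i \<le> m - n" "j \<le> \<eta>"
    and dec: "decodable G c emb B \<eta> j"
  defines "D \<equiv> PiE {..<(m - n) div c} (\<lambda>_. B)"
    and "a \<equiv> n + 2 * (\<eta> * c) * i"
  shows "real (card D) * (j * log 2 (card B) / (8 * w)) \<le>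
    (\<Sum>\<omega>\<in>D. real (card (transfer A (block_stream n m c emb \<omega>) a (a + \<eta> * c) (a + 2 * (\<eta> * c)))))"
proof -
  define N where "N = (m - n) div c"
  define J where "J = {2 * \<eta> * i..<2 * \<eta> * i + j}"
  let ?xs = "block_stream n m c emb"
  let ?r = "\<lambda>\<omega>. restrict \<omega> (- J)"
  let ?g = "\<lambda>\<omega>. real (card (transfer A (?xs \<omega>) a (a + \<eta> * c) (a + 2 * (\<eta> * c))))"
  have finD: "finite D" unfolding D_def using B(1) by (intro finite_PiE) auto
  have cB: "card B \<ge> 1" using B by (simp add: Suc_leI card_gt_0_iff)
  have DN: "D = PiE {..<N} (\<lambda>_. B)" by (simp add: D_def N_def)
  have xsD: "?xs \<omega> \<in> strings q m" if "\<omega> \<in> D" for \<omega>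
    using that assms by (intro block_stream_strings[where B = B]) (auto simp: D_def)
  have aligned: "a = n + (2 * \<eta> * i) * c" by (simp add: a_def)
  have "(2 * \<eta> * i + 2 * \<eta>) * c \<le> m - n" using \<eta>(2) by (simp add: algebra_simps)
  then have blocks: "2 * \<eta> * i + 2 * \<eta> \<le> N"
    unfolding N_def using assms(6) by (simp add: less_eq_div_iff_mult_less_eq)
  then have JN: "J \<subseteq> {..<N}" using \<eta>(3) unfolding J_def by auto
  have am: "a + 2 * (\<eta> * c) \<le> m" using \<eta>(2) assms(7) unfolding a_def by (simp add: algebra_simps)
  have jc: "j * c \<le> \<eta> * c" using \<eta>(3) by simp
  have agree: "?xs \<omega> ! t = ?xs \<omega>' ! t"
    if r: "?r \<omega> = ?r \<omega>'" and t: "t < m" "t \<notin> {a..<a + j * c}" for \<omega> \<omega>' t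
  proof (cases "n \<le> t")
    case True
    have "(t - n) div c \<notin> J"
    proof
      assume "(t - n) div c \<in> J"
      then have "2 * \<eta> * i \<le> (t - n) div c" "Suc ((t - n) div c) \<le> 2 * \<eta> * i + j"
        unfolding J_def by auto
      then have "(2 * \<eta> * i) * c \<le> (t - n) div c * c" "Suc ((t - n) div c) * c \<le> (2 * \<eta> * i + j) * c"
        by (auto intro: mult_le_mono1 simp del: mult_Suc)
      moreover have "Suc ((t - n) div c) * c = (t - n) div c * c + c"
        "(2 * \<eta> * i + j) * c = (2 * \<eta> * i) * c + j * c" by (simp_all add: algebra_simps)
      moreover have "(t - n) div c * c + (t - n) mod c = t - n" "(t - n) mod c < c"
        using assms(6) by auto
      ultimately show False using t True unfolding aligned atLeastLessThan_iff by linarith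
    qed
    then have "\<omega> ((t - n) div c) = \<omega>' ((t - n) div c)" using fun_cong[OF r, of "(t - n) div c"] by simp
    with True t show ?thesis by (simp add: block_stream_nth)
  qed (simp add: block_stream_def nth_append)
  have symbol: "?xs \<omega> ! (a + (k * c + x)) = emb (\<omega> (2 * \<eta> * i + k)) x" if "k < j" "x < c" for \<omega> k x
  proof -
    have eq: "a + (k * c + x) - n = (2 * \<eta> * i + k) * c + x" by (simp add: aligned algebra_simps)
    have "k * c + x < j * c"
      using that mult_le_mono1[of "Suc k" j c] by simp
    then have "a + (k * c + x) < m" using am jc by linarith
    moreover have "((2 * \<eta> * i + k) * c + x) div c = 2 * \<eta> * i + k"
      "((2 * \<eta> * i + k) * c + x) mod c = x"
      using that(2) by simp_all
    moreover have "2 * \<eta> * i + k < N" using that(1) \<eta>(3) blocks by linarith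
    ultimately show ?thesis
      by (subst block_stream_nth, simp add: aligned, simp, simp only: eq N_def[symmetric] if_True)
  qed
  have inj: "\<omega> = \<omega>'"
    if \<omega>: "\<omega> \<in> D" "\<omega>' \<in> D" and r: "?r \<omega> = ?r \<omega>'"
      and ans: "\<forall>t\<in>{a + \<eta> * c..<a + 2 * (\<eta> * c)}. answer A (?xs \<omega>) t = answer A (?xs \<omega>') t" for \<omega> \<omega>'
  proof -
    have matches: "(\<Sum>k<j. \<Sum>x<c. of_bool (emb (\<omega> (2 * \<eta> * i + k)) x = G (t - (k * c + x))) :: nat) =
        (\<Sum>k<j. \<Sum>x<c. of_bool (emb (\<omega>' (2 * \<eta> * i + k)) x = G (t - (k * c + x))))"
      if t: "t \<in> {\<eta> * c..<2 * \<eta> * c}" for t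
    proof -
      have conv: "(\<Sum>T\<in>{a..<a + j * c}. of_bool (?xs \<upsilon> ! T = G (a + t - T)) :: nat) =
          (\<Sum>k<j. \<Sum>x<c. of_bool (emb (\<upsilon> (2 * \<eta> * i + k)) x = G (t - (k * c + x))))" for \<upsilon>
      proof -
        have "(\<Sum>T\<in>{a..<a + j * c}. of_bool (?xs \<upsilon> ! T = G (a + t - T)) :: nat) =
            (\<Sum>\<tau><j * c. of_bool (?xs \<upsilon> ! (a + \<tau>) = G (t - \<tau>)))"
          by (simp add: sum.atLeastLessThan_shift_0[of _ a] atLeast0LessThan)
        also have "\<dots> = (\<Sum>k<j. \<Sum>x<c. of_bool (?xs \<upsilon> ! (a + (k * c + x)) = G (t - (k * c + x))))"
          by (rule sum_lessThan_times)
        finally show ?thesis using symbol[of _ _ \<upsilon>] by simp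
      qed
      have "(\<Sum>T\<in>{a..<a + j * c}. of_bool (?xs \<omega> ! T = G (a + t - T)) :: nat) =
          (\<Sum>T\<in>{a..<a + j * c}. of_bool (?xs \<omega>' ! T = G (a + t - T)))"
      proof (rule matches_eq_if_answer_eq[OF A(2) xsD[OF \<omega>(1)] xsD[OF \<omega>(2)]])
        show "n \<le> Suc (a + t)" by (simp add: a_def)
        show "a + t < m" using t am by simp
        show "Suc (a + t) \<le> a + n" using t \<eta>(1) by auto
        show "a + j * c \<le> Suc (a + t)" using order.trans[OF jc, of "a + t"] jc t unfolding atLeastLessThan_iff by linarith
        show "\<And>T. T < m \<Longrightarrow> T \<notin> {a..<a + j * c} \<Longrightarrow> ?xs \<omega> ! T = ?xs \<omega>' ! T" by (rule agree[OF r])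
        show "answer A (?xs \<omega>) (a + t) = answer A (?xs \<omega>') (a + t)" using ans t by auto
      qed
      then show ?thesis unfolding conv .
    qed
    have mem: "\<omega> (2 * \<eta> * i + k) \<in> B \<and> \<omega>' (2 * \<eta> * i + k) \<in> B" if "k < j" for k
    proof -
      have "2 * \<eta> * i + k \<in> {..<N}" using that blocks \<eta>(3) unfolding lessThan_iff by linarith
      with \<omega> show ?thesis unfolding DN by (meson PiE_mem)
    qed
    have dec': "\<forall>k<j. \<omega> (2 * \<eta> * i + k) = \<omega>' (2 * \<eta> * i + k)"
      using dec[unfolded decodable_def, rule_format,
          of "\<lambda>k. \<omega> (2 * \<eta> * i + k)" "\<lambda>k. \<omega>' (2 * \<eta> * i + k)"] mem matches by blast
    show "\<omega> = \<omega>'"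
    proof
      fix k
      show "\<omega> k = \<omega>' k"
      proof (cases "k \<in> J")
        case True
        then have "k = 2 * \<eta> * i + (k - 2 * \<eta> * i)" "k - 2 * \<eta> * i < j" unfolding J_def by auto
        with dec' show ?thesis by metis
      next
        case False
        then show ?thesis using fun_cong[OF r, of k] by simp
      qed
    qed
  qed
  have "real (card D) * (log 2 (real (card B ^ j)) * (1 / (8 * w))) \<le> sum ?g D"
  proof (rule sum_fibres_ge[OF finD, where r = ?r])
    show "1 \<le> real (card B ^ j)" using cB by (metis of_nat_1 of_nat_le_iff one_le_power)
    show "0 \<le> 1 / real (8 * w)" by simp
    fix y assume "y \<in> ?r ` D"
    then obtain \<omega>0 where \<omega>0: "\<omega>0 \<in> D" "y = ?r \<omega>0" by auto
    let ?E = "{\<omega> \<in> D. ?r \<omega> = y}"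
    \<comment> \<open>Grafting any free blocks onto \<open>\<omega>0\<close> stays in its fibre,
      which therefore has at least \<open>card B ^ j\<close> elements.\<close>
    let ?ext = "\<lambda>\<phi> k. if k \<in> J then \<phi> k else \<omega>0 k"
    have "card B ^ j = card (PiE J (\<lambda>_. B))"
      by (simp add: card_PiE J_def)
    also have "\<dots> \<le> card ?E"
    proof (rule card_inj_on_le[of ?ext])
      show "inj_on ?ext (PiE J (\<lambda>_. B))"
        by (rule inj_onI, rule PiE_ext) (auto dest!: fun_cong split: if_splits)
      show "?ext ` PiE J (\<lambda>_. B) \<subseteq> ?E"
        using \<omega>0 JN unfolding DN by (auto simp: PiE_def Pi_def extensional_def restrict_def)
      show "finite ?E" using finD by simp
    qed
    finally have "real (card B ^ j) \<le> real (card ?E)" by (rule of_nat_mono)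
    moreover have "real (card ?E) * (log 2 (card ?E) / (8 * w)) \<le> (\<Sum>\<omega>\<in>?E. ?g \<omega>)"
    proof (rule sum_card_transfer_ge[OF A(1) assms(3)])
      show "finite ?E" using finD by simp
      show "a + 2 * (\<eta> * c) \<le> m" by (rule am)
      show "?xs \<omega> \<in> strings q m" if "\<omega> \<in> ?E" for \<omega> using that xsD by simp
      show "?xs \<omega> ! t = ?xs \<omega>' ! t"
        if "\<omega> \<in> ?E" "\<omega>' \<in> ?E" "t < m" "t \<notin> {a..<a + \<eta> * c}" for \<omega> \<omega>' t
      proof (rule agree)
        show "?r \<omega> = ?r \<omega>'" using that(1,2) by simp
        show "t \<notin> {a..<a + j * c}" using that(4) jc unfolding atLeastLessThan_iff by linarith
      qed (rule that(3))
      show "\<omega> = \<omega>'" if "\<omega> \<in> ?E" "\<omega>' \<in> ?E"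
        "\<forall>t\<in>{a + \<eta> * c..<a + 2 * (\<eta> * c)}. answer A (?xs \<omega>) t = answer A (?xs \<omega>') t" for \<omega> \<omega>'
        by (rule inj[OF _ _ _ that(3)]) (use that(1,2) in simp_all)
    qed auto
    ultimately show "real (card B ^ j) \<le> real (card ?E) \<and>
        real (card ?E) * (log 2 (card ?E) * (1 / (8 * w))) \<le> (\<Sum>\<omega>\<in>?E. ?g \<omega>)" by simp
  qed
  moreover have "log 2 (real (card B ^ j)) = j * log 2 (card B)"
    using cB by (simp add: log_nat_power)
  ultimately show ?thesis by simp
qed

text \<open>For \<open>h = \<eta> * c\<close>, the times \<open>s\<close> and \<open>t\<close> lie
  in different grid intervals of length \<open>h\<close> but in the same one of length
  \<open>2 * h\<close>. They stay together at all longer scales, these being multiples of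
  \<open>2 * h\<close>, so only one scale separates them in this way.\<close>

lemma block_nodes_disjoint:
  fixes \<eta> \<eta>' c i i' n s t :: nat
  assumes "\<eta> = l * 2 ^ p" "\<eta>' = l * 2 ^ p'" "l \<ge> 1" "c \<ge> 1"
    and "s \<in> {n + 2 * (\<eta> * c) * i..<n + 2 * (\<eta> * c) * i + \<eta> * c}"
    and "t \<in> {n + 2 * (\<eta> * c) * i + \<eta> * c..<n + 2 * (\<eta> * c) * i + 2 * (\<eta> * c)}"
    and "s \<in> {n + 2 * (\<eta>' * c) * i'..<n + 2 * (\<eta>' * c) * i' + \<eta>' * c}"
    and "t \<in> {n + 2 * (\<eta>' * c) * i' + \<eta>' * c..<n + 2 * (\<eta>' * c) * i' + 2 * (\<eta>' * c)}"
  shows "p = p' \<and> i = i'"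
proof -
  have div: "(s - n) div h = 2 * i \<and> (t - n) div h = 2 * i + 1 \<and> (s - n) div (2 * h) = i \<and> (t - n) div (2 * h) = i"
    if "s \<in> {n + 2 * h * i..<n + 2 * h * i + h}"
      "t \<in> {n + 2 * h * i + h..<n + 2 * h * i + 2 * h}" for h i
  proof -
    define x y where "x = s - (n + 2 * h * i)" and "y = t - (n + 2 * h * i + h)"
    have xy: "x < h" "y < h" "s - n = x + (2 * i) * h" "t - n = y + (2 * i + 1) * h"
        "s - n = x + i * (2 * h)" "t - n = (h + y) + i * (2 * h)"
      using that unfolding x_def y_def by (auto simp: algebra_simps)
    have "(s - n) div h = 2 * i" using xy(1) unfolding xy(3) by simp
    moreover have "(t - n) div h = 2 * i + 1"
      unfolding xy(4) using xy(2) by (subst div_mult_self1) auto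
    moreover have "(s - n) div (2 * h) = i" using xy(1) unfolding xy(5) by (subst div_mult_self1) auto
    moreover have "(t - n) div (2 * h) = i" using xy(2) unfolding xy(6) by (subst div_mult_self1) auto
    ultimately show ?thesis by simp
  qed
  note d = div[OF assms(5,6)] div[OF assms(7,8)]
  have False if "p1 < p2" "h1 = l * 2 ^ p1 * c" "h2 = l * 2 ^ p2 * c"
    "(s - n) div (2 * h1) = (t - n) div (2 * h1)" "(s - n) div h2 \<noteq> (t - n) div h2" for p1 p2 h1 h2
  proof -
    have "p2 = p1 + 1 + (p2 - p1 - 1)" using that(1) by simp
    then have "(2::nat) ^ p2 = 2 ^ p1 * 2 * 2 ^ (p2 - p1 - 1)" by (metis power_add power_one_right)
    then have "h2 = (2 * h1) * 2 ^ (p2 - p1 - 1)" using that(2,3) by simp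
    then show False using that(4,5) by (simp add: div_mult2_eq)
  qed
  note False = this
  have "\<not> p < p'" using False[of p p' "\<eta> * c" "\<eta>' * c"] d assms(1,2) by auto
  moreover have "\<not> p' < p" using False[of p' p "\<eta>' * c" "\<eta> * c"] d assms(1,2) by auto
  ultimately have "p = p'" by simp
  with d assms(1,2) show ?thesis by auto
qed

text \<open>\<open>\<kappa>\<close> bounds the entropy per symbol of the first intervals from below.
  Each scale contributes order \<open>\<kappa> / w\<close> per arrival, whatever its length, and the
  charges of different scales are disjoint. \<open>P\<close> is left open because a string may serve
  only some of the scales.\<close>

lemma exists_hard_block_stream:
  fixes n m q w c l :: nat and j :: "nat \<Rightarrow> nat" and \<kappa> :: real
  assumes R: "randomised_solves_online_hamming w q (map (\<lambda>i. G (n - 1 - i)) [0..<n]) R"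
    and "w \<ge> 1" "n \<ge> 1" "q \<ge> 1" "c \<ge> 1" "l \<ge> 1" "2 * n \<le> m"
    and B: "finite B" "B \<noteq> {}" "\<And>\<phi> x. \<phi> \<in> B \<Longrightarrow> x < c \<Longrightarrow> emb \<phi> x < q"
    and P: "finite P" "\<And>p. p \<in> P \<Longrightarrow> 2 * (l * 2 ^ p * c) \<le> n" "\<And>p. p \<in> P \<Longrightarrow> j p \<le> l * 2 ^ p"
    and dec: "\<And>p. p \<in> P \<Longrightarrow> decodable G c emb B (l * 2 ^ p) (j p)"
    and \<kappa>: "\<kappa> \<ge> 0" "\<And>p. p \<in> P \<Longrightarrow> \<kappa> * (l * 2 ^ p * c) \<le> j p * log 2 (card B)"
  shows "\<exists>xs\<in>strings q m. ennreal (card P * \<kappa> / (64 * w)) \<le> expected_amortised_time R xs"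
proof -
  define D where "D = PiE {..<(m - n) div c} (\<lambda>_. B)"
  define h where "h p = l * 2 ^ p * c" for p
  define V where "V = Sigma P (\<lambda>p. {..<(m - n) div (2 * h p)})"
  let ?xs = "block_stream n m c emb"
  let ?a = "\<lambda>v. n + 2 * h (fst v) * snd v"
  let ?T = "\<lambda>\<omega> A v. card (transfer A (?xs \<omega>) (?a v) (?a v + h (fst v)) (?a v + 2 * h (fst v)))"
  have D: "finite D" "D \<noteq> {}" unfolding D_def using B by (auto intro!: finite_PiE simp: PiE_eq_empty_iff)
  have xsD: "?xs \<omega> \<in> strings q m" if "\<omega> \<in> D" for \<omega>
    using that assms by (intro block_stream_strings[where B = B]) (auto simp: D_def)
  have h1: "h p \<ge> 1" for p using assms(5,6) by (simp add: h_def)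
  have fits: "2 * h p * Suc i \<le> m - n" if "i < (m - n) div (2 * h p)" for p i
  proof -
    have "Suc i * (2 * h p) \<le> (m - n) div (2 * h p) * (2 * h p)" using that by (intro mult_le_mono1) simp
    also have "\<dots> \<le> m - n" by simp
    finally show ?thesis by (simp add: mult.commute)
  qed
  have "\<exists>\<omega>\<in>D. ennreal (card P * \<kappa> / (64 * w)) \<le> expected_amortised_time R (?xs \<omega>)"
  proof (rule exists_expected_amortised_time_ge[OF R D, where xs = ?xs and m = m])
    show "\<And>\<omega>. \<omega> \<in> D \<Longrightarrow> ?xs \<omega> \<in> strings q m" by (rule xsD)
    show "m > 0" using assms(3,7) by simp
    fix A assume A: "cell_probe_algorithm w q A"
      "solves_online_hamming q (map (\<lambda>i. G (n - 1 - i)) [0..<n]) A"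
    have node: "real (card D) * (\<kappa> * h p / (8 * w)) \<le> (\<Sum>\<omega>\<in>D. real (?T \<omega> A (p, i)))"
      if "p \<in> P" "i < (m - n) div (2 * h p)" for p i
    proof -
      have "real (card D) * (\<kappa> * h p / (8 * w)) \<le> real (card D) * (j p * log 2 (card B) / (8 * w))"
        using \<kappa>(2)[OF that(1)] by (intro mult_left_mono divide_right_mono) (auto simp: h_def)
      also have "\<dots> \<le> (\<Sum>\<omega>\<in>D. real (?T \<omega> A (p, i)))"
        using block_node_transfer_ge[OF A assms(2-5) _ B _ _ P(3)[OF that(1)] dec[OF that(1)], where m = m and i = i]
          P(2)[OF that(1)] fits[OF that(2)] assms(7)
        by (simp add: D_def h_def)
      finally show ?thesis .
    qed
    have "real (card D) * (m * (card P * \<kappa> / (64 * w))) = (\<Sum>p\<in>P. real (card D) * (m * \<kappa> / (64 * w)))"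
      by simp
    also have "\<dots> \<le> (\<Sum>p\<in>P. \<Sum>i<(m - n) div (2 * h p). real (card D) * (\<kappa> * h p / (8 * w)))"
    proof (rule sum_mono)
      fix p assume p: "p \<in> P"
      define N where "N = (m - n) div (2 * h p)"
      have "N \<ge> 1" unfolding N_def using P(2)[OF p] assms(7) h1[of p]
        by (simp add: h_def less_eq_div_iff_mult_less_eq)
      \<comment> \<open>The final factor 8 has three sources of at most 2 each: an incomplete last
        pair, the half of each pair that is not counted, and the \<open>n\<close> leading
        symbols.\<close>
      have "m - n < 2 * h p + N * (2 * h p)"
        unfolding N_def using h1[of p] dividend_less_div_times[of "2 * h p" "m - n"] by simp
      also have "\<dots> \<le> N * (2 * h p) + N * (2 * h p)" using \<open>N \<ge> 1\<close> by simp
      finally have "m - n \<le> 4 * (N * h p)" by simp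
      then have "m \<le> 8 * (N * h p)" using assms(7) by linarith
      then have "real m \<le> 8 * (real N * real (h p))" by (metis of_nat_le_iff of_nat_mult of_nat_numeral)
      then have "real m * (\<kappa> / (64 * w)) \<le> 8 * (real N * real (h p)) * (\<kappa> / (64 * w))"
        using \<kappa>(1) by (intro mult_right_mono) auto
      then have "real (card D) * (m * \<kappa> / (64 * w)) \<le> real (card D) * (N * (\<kappa> * h p / (8 * w)))"
        by (intro mult_left_mono) (auto simp: field_simps)
      then show "real (card D) * (m * \<kappa> / (64 * w)) \<le>
          (\<Sum>i<(m - n) div (2 * h p). real (card D) * (\<kappa> * h p / (8 * w)))"
        by (simp add: N_def mult_ac)
    qed
    also have "\<dots> \<le> (\<Sum>p\<in>P. \<Sum>i<(m - n) div (2 * h p). \<Sum>\<omega>\<in>D. real (?T \<omega> A (p, i)))"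
      using node by (intro sum_mono) auto
    also have "\<dots> = (\<Sum>v\<in>V. \<Sum>\<omega>\<in>D. real (?T \<omega> A v))"
      unfolding V_def using P(1) by (subst sum.Sigma) (auto simp: case_prod_beta)
    also have "\<dots> = (\<Sum>\<omega>\<in>D. \<Sum>v\<in>V. real (?T \<omega> A v))" by (rule sum.swap)
    also have "\<dots> \<le> (\<Sum>\<omega>\<in>D. real (total_probes A (?xs \<omega>)))"
    proof (rule sum_mono)
      fix \<omega> assume "\<omega> \<in> D"
      then have len: "length (?xs \<omega>) = m" using xsD by (simp add: strings_def)
      have "(\<Sum>v\<in>V. ?T \<omega> A v) \<le> total_probes A (?xs \<omega>)"
      proof (rule sum_card_transfer_le_total_probes)
        show "finite V" unfolding V_def using P(1) by auto
        show "?a v + 2 * h (fst v) \<le> length (?xs \<omega>)" if "v \<in> V" for v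
          using fits[of "snd v" "fst v"] that len assms(7) unfolding V_def by (auto simp: algebra_simps)
        show "v = v'" if "s \<in> {?a v..<?a v + h (fst v)}" "t \<in> {?a v + h (fst v)..<?a v + 2 * h (fst v)}"
            "s \<in> {?a v'..<?a v' + h (fst v')}" "t \<in> {?a v' + h (fst v')..<?a v' + 2 * h (fst v')}" for v v' s t
          using block_nodes_disjoint[OF refl refl assms(6,5) that[unfolded h_def]] by (simp add: prod_eq_iff)
      qed
      then show "(\<Sum>v\<in>V. real (?T \<omega> A v)) \<le> real (total_probes A (?xs \<omega>))"
        unfolding of_nat_sum[symmetric] of_nat_le_iff .
    qed
    finally show "real (card D) * (m * (card P * \<kappa> / (64 * w))) \<le> (\<Sum>\<omega>\<in>D. real (total_probes A (?xs \<omega>)))" .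
  qed
  with xsD show ?thesis by blast
qed

section \<open>Small alphabets\<close>

definition log_parity :: "nat \<Rightarrow> nat" where
  "log_parity d = nat \<lfloor>log 2 (real d)\<rfloor> mod 2"

lemma log_parity_eq: "2 ^ p \<le> d \<Longrightarrow> d < 2 ^ (p + 1) \<Longrightarrow> log_parity d = p mod 2"
  unfolding log_parity_def using floor_log_nat_eq_if[of 2 p d] by simp

text \<open>
  Between times \<open>h + k - 1\<close> and \<open>h + k\<close> only symbol \<open>k\<close> crosses a change of \<open>log_parity\<close>, apart
  from later symbols. Hence the symbols are recovered in decreasing order.
\<close>

lemma decodable_log_parity: "decodable log_parity 1 (\<lambda>v x. v) {0, 1} (2 ^ p) (2 ^ p)"
  unfolding decodable_def
proof (intro allI impI)
  fix \<phi> \<psi> :: "nat \<Rightarrow> nat" and k :: nat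
  define h :: nat where "h = 2 ^ p"
  assume bin: "\<forall>k<2 ^ p. \<phi> k \<in> {0, 1} \<and> \<psi> k \<in> {0, 1}"
    and eq: "\<forall>t\<in>{2 ^ p * 1..<2 * 2 ^ p * 1}.
      (\<Sum>k<2 ^ p. \<Sum>x<1. of_bool (\<phi> k = log_parity (t - (k * 1 + x))) :: nat) =
      (\<Sum>k<2 ^ p. \<Sum>x<1. of_bool (\<psi> k = log_parity (t - (k * 1 + x))))"
    and k: "k < 2 ^ p"
  show "\<phi> k = \<psi> k"
  proof (rule ccontr)
    assume "\<phi> k \<noteq> \<psi> k"
    define k0 where "k0 = Max {k. k < h \<and> \<phi> k \<noteq> \<psi> k}"
    have "k0 \<in> {k. k < h \<and> \<phi> k \<noteq> \<psi> k}"
      unfolding k0_def using k \<open>\<phi> k \<noteq> \<psi> k\<close> by (intro Max_in) (auto simp: h_def)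
    then have k0: "k0 < h" "\<phi> k0 \<noteq> \<psi> k0" by auto
    have later: "\<phi> k = \<psi> k" if "k0 < k" "k < h" for k
    proof (rule ccontr)
      assume "\<phi> k \<noteq> \<psi> k"
      then have "k \<le> k0" unfolding k0_def using that by (intro Max_ge) auto
      with that show False by simp
    qed
    define e where "e k = int (\<phi> k) - int (\<psi> k)" for k
    \<comment> \<open>The sign of the string at a given age; it makes a difference of matches linear
      in \<open>e\<close>.\<close>
    define s where "s d = 2 * int (log_parity d) - 1" for d
    have sum0: "(\<Sum>k<k0. e k * s (t - k)) + e k0 * s (t - k0) = 0" if "t \<in> {h..<2 * h}" for t
    proof -
      have step: "int (of_bool (\<phi> k = log_parity (t - k))) - int (of_bool (\<psi> k = log_parity (t - k))) = e k * s (t - k)"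
        if "k < h" for k
      proof -
        have "log_parity (t - k) \<in> {0, 1}" unfolding log_parity_def by auto
        then show ?thesis using bin that unfolding e_def s_def h_def by auto
      qed
      have "(\<Sum>k<h. of_bool (\<phi> k = log_parity (t - k)) :: nat) = (\<Sum>k<h. of_bool (\<psi> k = log_parity (t - k)))"
        using eq that by (simp add: h_def)
      then have "0 = int (\<Sum>k<h. of_bool (\<phi> k = log_parity (t - k))) - int (\<Sum>k<h. of_bool (\<psi> k = log_parity (t - k)))"
        by simp
      also have "\<dots> = (\<Sum>k<h. e k * s (t - k))"
        unfolding of_nat_sum sum_subtractf[symmetric] by (intro sum.cong refl step) auto
      also have "\<dots> = (\<Sum>k<Suc k0. e k * s (t - k))"
        using k0 later by (intro sum.mono_neutral_right) (auto simp: e_def)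
      finally show ?thesis by simp
    qed
    define \<sigma> where "\<sigma> = 2 * int (p mod 2) - 1"
    have s_high: "s d = \<sigma>" if "h \<le> d" "d < 2 * h" for d
      using that log_parity_eq[of p d] unfolding s_def \<sigma>_def h_def by simp
    have \<sigma>: "\<sigma> \<noteq> 0" unfolding \<sigma>_def by presburger
    have high: "(\<Sum>k<k0. e k * s (t - k)) = (\<Sum>k<k0. e k) * \<sigma>" if "h + k0 \<le> Suc t" "t < 2 * h" for t
      unfolding sum_distrib_right using that by (intro sum.cong refl) (subst s_high, auto)
    \<comment> \<open>At time \<open>h + k0\<close> all symbols up to \<open>k0\<close> have an age
      in \<open>{h..<2 * h}\<close>, where the sign is constant.\<close>
    have "(\<Sum>k<k0. e k) * \<sigma> + e k0 * \<sigma> = 0"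
      using sum0[of "h + k0"] high[of "h + k0"] s_high[of h] k0(1) by simp
    then have zero: "(\<Sum>k<k0. e k) + e k0 = 0" using \<sigma> by (simp flip: distrib_right)
    \<comment> \<open>For \<open>k0 = 0\<close> the time \<open>h - 1\<close> lies before the second
      interval, but then the sum over smaller \<open>k\<close> is empty and one equation
      suffices.\<close>
    have "e k0 = 0"
    proof (cases k0)
      case 0
      with zero show ?thesis by simp
    next
      case (Suc k')
      with k0 have "p > 0" by (cases p) (auto simp: h_def)
      then obtain p' where p': "p = Suc p'" by (cases p) auto
      have "log_parity (h - 1) = p' mod 2"
        by (rule log_parity_eq) (auto simp: h_def p')
      then have low: "s (h - 1) = - \<sigma>"
        unfolding s_def \<sigma>_def p' by presburger
      have "h + k' - k0 = h - 1" using Suc by simp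
      then have "(\<Sum>k<k0. e k) * \<sigma> - e k0 * \<sigma> = 0"
        using sum0[of "h + k'"] high[of "h + k'"] low k0(1) Suc by simp
      then have "(\<Sum>k<k0. e k) - e k0 = 0" using \<sigma> by (simp flip: left_diff_distrib)
      with zero show ?thesis by simp
    qed
    with k0(2) show False by (simp add: e_def)
  qed
qed

lemma power_le_if_le_log2:
  fixes k n :: nat
  assumes "real k \<le> log 2 n" "n \<ge> 1"
  shows "2 ^ k \<le> n"
proof -
  have "real (2 ^ k) \<le> real n" using assms by (simp add: le_log_iff powr_realpow)
  then show ?thesis by (simp only: of_nat_le_iff)
qed

lemma exists_hard_binary_stream:
  assumes R: "randomised_solves_online_hamming w q (map (\<lambda>i. log_parity (n - 1 - i)) [0..<n]) R"
    and "w \<ge> 1" "n \<ge> 2" "q \<ge> 2" "2 * n \<le> m"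
  shows "\<exists>xs\<in>strings q m. ennreal (log 2 n / (128 * w)) \<le> expected_amortised_time R xs"
proof -
  define L where "L = nat \<lfloor>log 2 n\<rfloor>"
  have log1: "log 2 n \<ge> 1" using assms(3) by simp
  then have L: "real L \<le> log 2 n" "log 2 n < real L + 1" "L \<ge> 1" unfolding L_def by linarith+
  have "\<exists>xs\<in>strings q m. ennreal (real (card {..<L}) * 1 / (64 * w)) \<le> expected_amortised_time R xs"
  proof (rule exists_hard_block_stream[OF R, where c = 1 and l = 1 and B = "{0, 1}" and emb = "\<lambda>v x. v"
        and j = "\<lambda>p. 2 ^ p" and \<kappa> = 1])
    show "2 * (1 * 2 ^ p * 1) \<le> n" if "p \<in> {..<L}" for p
    proof -
      have "(2::nat) * (1 * 2 ^ p * 1) = 2 ^ Suc p" by simp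
      also have "\<dots> \<le> 2 ^ L" using that by (intro power_increasing) auto
      also have "2 ^ L \<le> n" by (rule power_le_if_le_log2) (use L(1) assms(3) in auto)
      finally show ?thesis .
    qed
  qed (use assms decodable_log_parity in auto)
  then obtain xs where xs: "xs \<in> strings q m" "ennreal (L / (64 * w)) \<le> expected_amortised_time R xs" by auto
  \<comment> \<open>As \<open>L \<ge> 1\<close>, the floor loses at most a factor 2.\<close>
  have "log 2 n / (128 * w) \<le> (2 * L) / (128 * w)" using L by (intro divide_right_mono) linarith+
  also have "\<dots> = L / (64 * w)" by simp
  finally show ?thesis using xs ennreal_leI order.trans by blast
qed

section \<open>Coin weighing\<close>

lemma sum_lessThan_add: "(\<Sum>i<a + b. f i) = (\<Sum>i<a. f i) + (\<Sum>i<b. f (a + i :: nat) :: 'a::comm_monoid_add)"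
  by (induction b) (simp_all add: add.assoc)

text \<open>
  The recursive coin weighing matrix of Cantor and Mills: from \<open>M\<close> one gets the block matrix with
  rows \<open>(M, M, I)\<close> and \<open>(M, -M, 0)\<close>. Adding both halves of a product isolates the last block modulo 2.
\<close>

lemma exists_detecting_matrix:
  "\<exists>M :: nat \<Rightarrow> nat \<Rightarrow> int. (\<forall>y x. M y x \<in> {-1, 0, 1}) \<and>
     (\<forall>z. (\<forall>x<k * 2 ^ (k - 1). \<bar>z x\<bar> \<le> 1) \<longrightarrow> (\<forall>y<2 ^ k. (\<Sum>x<k * 2 ^ (k - 1). M y x * z x) = 0) \<longrightarrow>
        (\<forall>x<k * 2 ^ (k - 1). z x = 0))"
proof (induction k)
  case 0
  show ?case by (intro exI[of _ "\<lambda>_ _. 0"]) auto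
next
  case (Suc k)
  define c :: nat where "c = k * 2 ^ (k - 1)"
  define R :: nat where "R = 2 ^ k"
  \<comment> \<open>\<open>z\<close> stands for the difference of two 0-1 vectors, so its entries
    are -1, 0 or 1.\<close>
  from Suc obtain M :: "nat \<Rightarrow> nat \<Rightarrow> int" where M: "\<And>y x. M y x \<in> {-1, 0, 1}"
    and det: "\<And>z. (\<forall>x<c. \<bar>z x\<bar> \<le> 1) \<Longrightarrow> (\<forall>y<R. (\<Sum>x<c. M y x * z x) = 0) \<Longrightarrow> (\<forall>x<c. z x = 0)"
    unfolding c_def R_def by blast
  define M' where "M' y x = (if y < R then if x < c then M y x else if x < c + c then M y (x - c)
      else of_bool (x = c + c + y) else if x < c then M (y - R) x else if x < c + c then - M (y - R) (x - c) else 0)" for y x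
  \<comment> \<open>The recursion doubles the columns and adds \<open>2 ^ k\<close> new ones. At
    \<open>k = 0\<close> the truncated exponent meets a factor 0.\<close>
  have cols: "Suc k * 2 ^ (Suc k - 1) = c + c + R"
    by (cases k) (simp_all add: c_def R_def)
  have rows: "(2::nat) ^ Suc k = R + R" by (simp add: R_def)
  have M': "M' y x \<in> {-1, 0, 1}" for y x
    unfolding M'_def using M[of y x] M[of y "x - c"] M[of "y - R" x] M[of "y - R" "x - c"] by auto
  have "\<forall>x<c + c + R. z x = 0"
    if z: "\<forall>x<c + c + R. \<bar>z x\<bar> \<le> 1" and zero: "\<forall>y<R + R. (\<Sum>x<c + c + R. M' y x * z x) = 0" for z
  proof -
    have top: "(\<Sum>x<c. M y x * z x) + (\<Sum>x<c. M y x * z (c + x)) + z (c + c + y) = 0" if "y < R" for y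
    proof -
      have "(\<Sum>x<c + c + R. M' y x * z x) = 0" using zero that by simp
      moreover have "(\<Sum>x<R. M' y (c + c + x) * z (c + c + x)) = (\<Sum>x<R. if x = y then z (c + c + x) else 0)"
        using that by (intro sum.cong) (auto simp: M'_def)
      ultimately show ?thesis using that by (simp add: sum_lessThan_add M'_def)
    qed
    have bottom: "(\<Sum>x<c. M y x * z x) - (\<Sum>x<c. M y x * z (c + x)) = 0" if "y < R" for y
    proof -
      have "(\<Sum>x<c + c + R. M' (R + y) x * z x) = 0" using zero that by simp
      then show ?thesis by (simp add: sum_lessThan_add M'_def sum_negf)
    qed
    have last: "z (c + c + y) = 0" if "y < R" for y
    proof -
      have "z (c + c + y) = - 2 * (\<Sum>x<c. M y x * z x)" using top[OF that] bottom[OF that] by linarith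
      moreover have "\<bar>z (c + c + y)\<bar> \<le> 1" using z that by simp
      ultimately show ?thesis by presburger
    qed
    have both: "(\<Sum>x<c. M y x * z x) = 0" "(\<Sum>x<c. M y x * z (c + x)) = 0" if "y < R" for y
      using top[OF that] bottom[OF that] last[OF that] by linarith+
    have "\<forall>x<c. z x = 0" using det[of z] z both(1) by simp
    moreover have "\<forall>x<c. z (c + x) = 0" using det[of "\<lambda>x. z (c + x)"] z both(2) by simp
    ultimately show ?thesis using last
      by (metis add_less_cancel_left le_add_diff_inverse not_le)
  qed
  then show ?case unfolding cols rows using M' by blast
qed

text \<open>
  An unknown number of \<open>b\<close> bits can be weighed only through one of its bits at a time. So \<open>b\<close> copies of
  the matrix are used, and bit \<open>\<beta>\<close> of unknown \<open>a * H + c\<close> becomes coin \<open>\<beta> * H + c\<close> of copy \<open>(a + \<beta>) mod b\<close>.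
\<close>

definition rotate_block :: "nat \<Rightarrow> nat \<Rightarrow> nat \<Rightarrow> nat \<Rightarrow> nat" where
  "rotate_block b H \<rho> x = ((\<rho> + b - x div H) mod b) * H + x mod H"

text \<open>\<open>x div H\<close> is sent to \<open>\<rho> - x div H\<close> modulo
  \<open>b\<close>, a reflection; the added \<open>b\<close> guards against truncated
  subtraction.\<close>

lemma rotate_block_involution:
  assumes "x < b * H" "\<rho> < b"
  shows "rotate_block b H \<rho> x < b * H" "rotate_block b H \<rho> (rotate_block b H \<rho> x) = x"
    "rotate_block b H \<rho> x div H = (\<rho> + b - x div H) mod b" "rotate_block b H \<rho> x mod H = x mod H"
proof -
  let ?a = "(\<rho> + b - x div H) mod b"
  have H: "H > 0" using assms by (cases H) auto
  have a: "?a < b" using assms by simp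
  have xb: "x div H < b" using assms(1) H by (simp add: less_mult_imp_div_less)
  have "Suc ?a * H \<le> b * H" using a by (intro mult_le_mono1) simp
  moreover have "x mod H < H" using H by simp
  ultimately show "rotate_block b H \<rho> x < b * H" unfolding rotate_block_def by simp
  show d: "rotate_block b H \<rho> x div H = ?a" and m: "rotate_block b H \<rho> x mod H = x mod H"
    using H by (simp_all add: rotate_block_def)
  have "(\<rho> + b - ?a) mod b = x div H"
  proof (cases "x div H \<le> \<rho>")
    case True
    then have "\<rho> + b - x div H = (\<rho> - x div H) + b" by simp
    then have "?a = \<rho> - x div H" using assms(2) by (simp only: mod_add_self2) simp
    then show ?thesis using True xb by simp
  next
    case False
    then have "?a = \<rho> + b - x div H" using xb by simp
    then show ?thesis using False xb by simp
  qed
  then show "rotate_block b H \<rho> (rotate_block b H \<rho> x) = x"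
    unfolding rotate_block_def[of b H \<rho> "rotate_block b H \<rho> x"] d m by simp
qed

text \<open>The ratio matters: \<open>b * 2 ^ b\<close> counts for \<open>b * 2 ^ (b - 1)\<close>
  numbers of \<open>b\<close> bits, that is \<open>b / 2\<close> bits per count, the source of the
  factor delta. \<open>W \<rho> y g v\<close> tells whether row \<open>y\<close> of copy
  \<open>\<rho>\<close> counts unknown \<open>g\<close> when its value is \<open>v\<close>.\<close>

lemma exists_weighings:
  fixes b :: nat
  assumes "b \<ge> 1"
  shows "\<exists>W :: nat \<Rightarrow> nat \<Rightarrow> nat \<Rightarrow> nat \<Rightarrow> bool. \<forall>X X' :: nat \<Rightarrow> nat.
    (\<forall>g<b * 2 ^ (b - 1). X g < 2 ^ b \<and> X' g < 2 ^ b) \<longrightarrow>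
    (\<forall>\<rho><b. \<forall>y<2 ^ b. (\<Sum>g<b * 2 ^ (b - 1). of_bool (W \<rho> y g (X g)) :: nat) =
        (\<Sum>g<b * 2 ^ (b - 1). of_bool (W \<rho> y g (X' g)))) \<longrightarrow>
    (\<forall>g<b * 2 ^ (b - 1). X g = X' g)"
proof -
  define H :: nat where "H = 2 ^ (b - 1)"
  from exists_detecting_matrix[of b] obtain M :: "nat \<Rightarrow> nat \<Rightarrow> int"
    where M: "\<And>y x. M y x \<in> {-1, 0, 1}"
      and det: "\<And>z. (\<forall>x<b * H. \<bar>z x\<bar> \<le> 1) \<Longrightarrow> (\<forall>y<2 ^ b. (\<Sum>x<b * H. M y x * z x) = 0) \<Longrightarrow> (\<forall>x<b * H. z x = 0)"
    unfolding H_def by blast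
  let ?rot = "rotate_block b H"
  \<comment> \<open>A count cannot subtract, so an entry -1 asks for the complemented bit. This
    differs from minus the bit by a constant, which cancels when two assignments are
    compared.\<close>
  define W where "W \<rho> y g v = (if M y (?rot \<rho> g) = 1 then bit v (?rot \<rho> g div H)
      else M y (?rot \<rho> g) = -1 \<and> \<not> bit v (?rot \<rho> g div H))" for \<rho> y g and v :: nat
  have "X g = X' g"
    if bound: "\<forall>g<b * H. X g < 2 ^ b \<and> X' g < 2 ^ b"
      and eq: "\<forall>\<rho><b. \<forall>y<2 ^ b. (\<Sum>g<b * H. of_bool (W \<rho> y g (X g)) :: nat) = (\<Sum>g<b * H. of_bool (W \<rho> y g (X' g)))"
      and g: "g < b * H" for X X' :: "nat \<Rightarrow> nat" and g
  proof -
    have bits: "bit (X g) \<beta> = bit (X' g) \<beta>" if \<beta>: "\<beta> < b" for \<beta>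
    proof -
      \<comment> \<open>The copy in which \<open>g\<close> is weighed through its bit
        \<open>\<beta>\<close>.\<close>
      define \<rho> where "\<rho> = (g div H + \<beta>) mod b"
      have \<rho>: "\<rho> < b" using assms by (simp add: \<rho>_def)
      define d where "d g \<beta> = (of_bool (bit (X g) \<beta>) - of_bool (bit (X' g) \<beta>) :: int)" for g \<beta>
      define z where "z x = d (?rot \<rho> x) (x div H)" for x
      have "\<forall>x<b * H. z x = 0"
      proof (rule det)
        show "\<forall>x<b * H. \<bar>z x\<bar> \<le> 1" by (simp add: z_def d_def)
        show "\<forall>y<2 ^ b. (\<Sum>x<b * H. M y x * z x) = 0"
        proof (intro allI impI)
          fix y :: nat assume y: "y < 2 ^ b"
          have "(\<Sum>x<b * H. M y x * z x) = (\<Sum>g<b * H. M y (?rot \<rho> g) * d g (?rot \<rho> g div H))"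
            using rotate_block_involution[OF _ \<rho>]
            by (intro sum.reindex_bij_witness[of _ "?rot \<rho>" "?rot \<rho>"]) (auto simp: z_def)
          also have "\<dots> = (\<Sum>g<b * H. int (of_bool (W \<rho> y g (X g))) - int (of_bool (W \<rho> y g (X' g))))"
          proof (rule sum.cong[OF refl])
            fix g
            show "M y (?rot \<rho> g) * d g (?rot \<rho> g div H) = int (of_bool (W \<rho> y g (X g))) - int (of_bool (W \<rho> y g (X' g)))"
              using M[of y "?rot \<rho> g"] by (auto simp: W_def d_def)
          qed
          also have "\<dots> = int (\<Sum>g<b * H. of_bool (W \<rho> y g (X g))) - int (\<Sum>g<b * H. of_bool (W \<rho> y g (X' g)))"
            by (simp only: sum_subtractf of_nat_sum)
          also have "\<dots> = 0" using eq \<rho> y by simp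
          finally show "(\<Sum>x<b * H. M y x * z x) = 0" .
        qed
      qed
      then have "z (?rot \<rho> g) = 0" using rotate_block_involution(1)[OF g \<rho>] by simp
      moreover have "(\<rho> + b - g div H) mod b = \<beta>"
      proof -
        have gH: "g div H < b" using g by (simp add: less_mult_imp_div_less)
        show ?thesis
        proof (cases "g div H + \<beta> < b")
          case False
          then have "\<rho> = g div H + \<beta> - b" using gH \<beta> by (simp add: \<rho>_def mod_if)
          then show ?thesis using False gH \<beta> by simp
        qed (use \<beta> in \<open>simp add: \<rho>_def\<close>)
      qed
      ultimately have "d g \<beta> = 0"
        using rotate_block_involution[OF g \<rho>] by (simp add: z_def)
      then show ?thesis by (auto simp: d_def of_bool_def split: if_splits)
    qed
    have "bit v \<beta> = False" if "v < 2 ^ b" "\<not> \<beta> < b" for v \<beta> :: nat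
    proof -
      have "(2::nat) ^ b \<le> 2 ^ \<beta>" using that(2) by (intro power_increasing) auto
      with that(1) have "v < 2 ^ \<beta>" by (rule less_le_trans)
      then show ?thesis by (simp add: bit_iff_odd)
    qed
    with bits bound g have "bit (X g) \<beta> = bit (X' g) \<beta>" for \<beta> by (cases "\<beta> < b") auto
    then show ?thesis by (rule bit_eqI)
  qed
  then show ?thesis unfolding H_def by (intro exI[of _ W]) blast
qed

section \<open>Large alphabets\<close>

text \<open>
  The fixed string holds, for every scale \<open>p\<close>, a cluster of \<open>c\<^sup>2\<close> symbols. A symbol is a pair of a
  position \<open>x < c\<close> within a block and a value. At a time congruent to \<open>r\<close> modulo \<open>c\<close> the
  position parts can only agree at the places \<open>8 c\<^sup>2 4\<^sup>p + r (c + 1) - x\<close> of the cluster, and these meet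
  a single block. Hence the number of matches is the agreement of this block with query \<open>r\<close>, which
  asks at the positions \<open>x\<close> with \<open>V r x\<close> for the value \<open>s r\<close>.
\<close>

definition cluster_symbol :: "nat \<Rightarrow> nat \<Rightarrow> (nat \<Rightarrow> nat \<Rightarrow> bool) \<Rightarrow> (nat \<Rightarrow> nat) \<Rightarrow> nat \<Rightarrow> nat \<Rightarrow> bool" where
  "cluster_symbol c S V s d u \<longleftrightarrow>
     (\<exists>p r x. r < c \<and> x < c \<and> V r x \<and> d + x = 8 * (c * c) * 4 ^ p + r * (c + 1) \<and> u = Suc (x * S + s r))"

text \<open>The symbol 0 marks an unoccupied place; codeword symbols will be successors, so it
  matches none of them. What the choice picks is settled in
  \<open>cluster_string_match\<close>.\<close>

definition cluster_string :: "nat \<Rightarrow> nat \<Rightarrow> (nat \<Rightarrow> nat \<Rightarrow> bool) \<Rightarrow> (nat \<Rightarrow> nat) \<Rightarrow> nat \<Rightarrow> nat" where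
  "cluster_string c S V s d =
     (if \<exists>u. cluster_symbol c S V s d u then SOME u. cluster_symbol c S V s d u else 0)"

lemma cluster_string_nonzero:
  assumes "cluster_string c S V s d \<noteq> 0"
  shows "cluster_symbol c S V s d (cluster_string c S V s d)"
  using assms unfolding cluster_string_def by (auto intro: someI split: if_splits)

lemma cluster_string_symbol:
  assumes "cluster_symbol c S V s d u"
  shows "cluster_symbol c S V s d (cluster_string c S V s d)"
  using assms unfolding cluster_string_def by (auto intro: someI)

lemma pair_code_less: "x < c \<Longrightarrow> v < S \<Longrightarrow> x * S + v < c * (S :: nat)"
  using mult_le_mono1[of "Suc x" c S] by simp

lemma pair_code_eq:
  assumes "v < S" "v' < S" "x * S + v = x' * S + (v' :: nat)"
  shows "x = x'" "v = v'"
proof -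
  have "(x * S + v) div S = x" "(x' * S + v') div S = x'" using assms(1,2) by simp_all
  then show "x = x'" using assms(3) by metis
  then show "v = v'" using assms(3) by simp
qed

lemma cluster_string_less:
  assumes "\<And>r. r < c \<Longrightarrow> s r < S" "c * S < q"
  shows "cluster_string c S V s d < q"
proof (cases "cluster_string c S V s d = 0")
  case False
  from cluster_string_nonzero[OF this] obtain r x
    where "r < c" "x < c" "cluster_string c S V s d = Suc (x * S + s r)"
    unfolding cluster_symbol_def by blast
  with pair_code_less[of x c "s r" S] assms show ?thesis by simp
qed (use assms in simp)

text \<open>In units of \<open>c * c * 4 ^ p\<close>, cluster \<open>p\<close> lies between 7 and 9,
  smaller ones below 3 and larger ones above 31, while the window for \<open>d\<close> runs from 4
  to 16. Within a cluster, \<open>r * (c + 1) - x\<close> determines both \<open>r\<close> and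
  \<open>x\<close>.\<close>

lemma cluster_string_match:
  assumes s: "\<And>r. r < c \<Longrightarrow> s r < S" and x: "x < c" and v: "v < S"
    and d: "4 * (c * c) * 4 ^ p < d" "d < 16 * (c * c) * 4 ^ p"
  shows "Suc (x * S + v) = cluster_string c S V s d \<longleftrightarrow>
    (\<exists>r<c. V r x \<and> s r = v \<and> d + x = 8 * (c * c) * 4 ^ p + r * (c + 1))"
proof -
  have scale: "p' = p" if eq: "d + y = 8 * (c * c) * 4 ^ p' + r * (c + 1)" and "r < c" "y < c" for p' r y
  proof (rule ccontr)
    have "Suc r * (c + 1) \<le> c * (c + 1)" using that(2) by (intro mult_le_mono1) simp
    then have r: "r * (c + 1) < c * c" by simp
    have y: "y < c * c" using that(3) by (cases c) auto
    assume "p' \<noteq> p"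
    then consider "p' < p" | "p < p'" by linarith
    then show False
    proof cases
      case 1
      then obtain e where "p = p' + Suc e" using less_imp_Suc_add by auto
      then have "(4::nat) ^ p = 4 * 4 ^ p' * 4 ^ e" by (simp add: power_add)
      moreover have "(1::nat) \<le> 4 ^ e" by simp
      ultimately have "4 * 4 ^ p' \<le> (4::nat) ^ p" by simp
      then have "c * c * (4 * 4 ^ p') \<le> c * c * 4 ^ p" by (rule mult_le_mono2)
      then have "4 * (c * c * 4 ^ p') \<le> c * c * 4 ^ p" by (simp only: mult_ac)
      moreover have "c * c * 1 \<le> c * c * 4 ^ p'" by (intro mult_le_mono2) simp
      moreover have "8 * (c * c) * 4 ^ p' = 8 * (c * c * 4 ^ p')" "4 * (c * c) * 4 ^ p = 4 * (c * c * 4 ^ p)"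
        by (simp_all only: mult.assoc)
      ultimately show False using eq r d(1) by linarith
    next
      case 2
      then obtain e where "p' = p + Suc e" using less_imp_Suc_add by auto
      then have "(4::nat) ^ p' = 4 * 4 ^ p * 4 ^ e" by (simp add: power_add)
      moreover have "(1::nat) \<le> 4 ^ e" by simp
      ultimately have "4 * 4 ^ p \<le> (4::nat) ^ p'" by simp
      then have "c * c * (4 * 4 ^ p) \<le> c * c * 4 ^ p'" by (rule mult_le_mono2)
      then have "4 * (c * c * 4 ^ p) \<le> c * c * 4 ^ p'" by (simp only: mult_ac)
      moreover have "c * c * 1 \<le> c * c * 4 ^ p" by (intro mult_le_mono2) simp
      moreover have "8 * (c * c) * 4 ^ p' = 8 * (c * c * 4 ^ p')" "16 * (c * c) * 4 ^ p = 16 * (c * c * 4 ^ p)"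
        by (simp_all only: mult.assoc)
      ultimately show False using eq y d(2) by linarith
    qed
  qed
  show ?thesis
  proof
    assume eq: "Suc (x * S + v) = cluster_string c S V s d"
    then have "cluster_string c S V s d \<noteq> 0" by simp
    from cluster_string_nonzero[OF this] obtain p' r x' where w: "r < c" "x' < c" "V r x'"
      "d + x' = 8 * (c * c) * 4 ^ p' + r * (c + 1)" "Suc (x * S + v) = Suc (x' * S + s r)"
      unfolding cluster_symbol_def eq[symmetric] by blast
    have "x = x'" "v = s r" using pair_code_eq[OF v s[OF w(1)]] w(5) by auto
    with w scale[OF w(4,1,2)] show "\<exists>r<c. V r x \<and> s r = v \<and> d + x = 8 * (c * c) * 4 ^ p + r * (c + 1)" by blast
  next
    assume "\<exists>r<c. V r x \<and> s r = v \<and> d + x = 8 * (c * c) * 4 ^ p + r * (c + 1)"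
    then obtain r where r: "r < c" "V r x" "s r = v" "d + x = 8 * (c * c) * 4 ^ p + r * (c + 1)" by blast
    then have "cluster_symbol c S V s d (Suc (x * S + v))" unfolding cluster_symbol_def using x by blast
    from cluster_string_symbol[OF this] obtain p' r' x' where w: "r' < c" "x' < c"
      "d + x' = 8 * (c * c) * 4 ^ p' + r' * (c + 1)" "cluster_string c S V s d = Suc (x' * S + s r')"
      unfolding cluster_symbol_def by blast
    have "d + x' = 8 * (c * c) * 4 ^ p + r' * (c + 1)" using w(3) scale[OF w(3,1,2)] by simp
    then have "r * (c + 1) + x' = r' * (c + 1) + x" using r(4) by linarith
    then have "r = r'" "x' = x" using pair_code_eq[of x' "c + 1" x r r'] x w(2) by auto
    with w(4) r(3) show "Suc (x * S + v) = cluster_string c S V s d" by simp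
  qed
qed

text \<open>The spacing \<open>c + 1\<close> isolates a block. Block \<open>k\<close> meets query
  \<open>r\<close> only at time \<open>k * c + r * (c + 1)\<close> after a fixed start; written as
  \<open>(k + r) * c + r\<close>, this reveals \<open>r\<close> as its last digit in base
  \<open>c\<close>, and then \<open>k\<close>. Only half of the blocks of an interval are used, so
  that ages stay above \<open>4 * (c * c) * 4 ^ p\<close>, clear of the smaller clusters.\<close>

lemma decodable_cluster_string:
  assumes s: "\<And>r. r < c \<Longrightarrow> s r < S"
    and val: "\<And>\<phi> x. \<phi> \<in> B \<Longrightarrow> x < c \<Longrightarrow> val \<phi> x < S"
    and inj: "\<And>\<phi> \<psi>. \<phi> \<in> B \<Longrightarrow> \<psi> \<in> B \<Longrightarrow>
      (\<And>r. r < c \<Longrightarrow> (\<Sum>x<c. of_bool (V r x \<and> s r = val \<phi> x) :: nat) = (\<Sum>x<c. of_bool (V r x \<and> s r = val \<psi> x))) \<Longrightarrow>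
      \<phi> = \<psi>"
  shows "decodable (cluster_string c S V s) c (\<lambda>\<phi> x. Suc (x * S + val \<phi> x)) B (8 * c * 4 ^ p) (4 * c * 4 ^ p)"
  unfolding decodable_def
proof (intro allI impI)
  fix \<phi> \<psi> :: "nat \<Rightarrow> 'a" and K
  let ?G = "cluster_string c S V s" and ?j = "4 * c * 4 ^ p"
  assume B: "\<forall>k<?j. \<phi> k \<in> B \<and> \<psi> k \<in> B" and K: "K < ?j"
    and eq: "\<forall>t\<in>{8 * c * 4 ^ p * c..<2 * (8 * c * 4 ^ p) * c}.
      (\<Sum>k<?j. \<Sum>x<c. of_bool (Suc (x * S + val (\<phi> k) x) = ?G (t - (k * c + x))) :: nat) =
      (\<Sum>k<?j. \<Sum>x<c. of_bool (Suc (x * S + val (\<psi> k) x) = ?G (t - (k * c + x))))"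
  show "\<phi> K = \<psi> K"
  proof (rule inj)
    show "\<phi> K \<in> B" "\<psi> K \<in> B" using B K by auto
    fix r assume r: "r < c"
    define W where "W = 4 ^ p * (c * c)"
    have W: "8 * c * 4 ^ p * c = 8 * W" "8 * (c * c) * 4 ^ p = 8 * W" "4 * (c * c) * 4 ^ p = 4 * W"
      "16 * (c * c) * 4 ^ p = 16 * W" "2 * (8 * c * 4 ^ p) * c = 16 * W" "?j * c = 4 * W"
      by (simp_all add: W_def mult_ac)
    define t where "t = K * c + 8 * W + r * (c + 1)"
    have "1 * (c * c) \<le> W" unfolding W_def by (intro mult_le_mono1) simp
    moreover have "Suc r * (c + 1) \<le> c * (c + 1)" using r by (intro mult_le_mono1) simp
    then have "r * (c + 1) < c * c" by simp
    ultimately have rW: "r * (c + 1) < W" by simp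
    have block: "k * c + x < 4 * W" if "k < ?j" "x < c" for k x
      using pair_code_less[OF that] W(6) by simp
    have t': "8 * W \<le> t" "t < 16 * W"
      using block[OF K r] rW unfolding t_def by linarith+
    then have t: "t \<in> {8 * c * 4 ^ p * c..<2 * (8 * c * 4 ^ p) * c}" by (simp only: W atLeastLessThan_iff)
    have matches: "(\<Sum>k<?j. \<Sum>x<c. of_bool (Suc (x * S + val (\<upsilon> k) x) = ?G (t - (k * c + x))) :: nat) =
        (\<Sum>x<c. of_bool (V r x \<and> s r = val (\<upsilon> K) x))" if \<upsilon>: "\<forall>k<?j. \<upsilon> k \<in> B" for \<upsilon>
    proof -
      have "(Suc (x * S + val (\<upsilon> k) x) = ?G (t - (k * c + x))) \<longleftrightarrow> k = K \<and> V r x \<and> s r = val (\<upsilon> K) x"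
        if k: "k < ?j" and x: "x < c" for k x
      proof -
        let ?d = "t - (k * c + x)"
        have kx: "k * c + x < 4 * W" by (rule block[OF k x])
        have d: "4 * (c * c) * 4 ^ p < ?d" "?d < 16 * (c * c) * 4 ^ p"
          unfolding W using t' kx by linarith+
        have "?d + x = 8 * (c * c) * 4 ^ p + r' * (c + 1) \<longleftrightarrow> k = K \<and> r' = r" if "r' < c" for r'
        proof -
          have "?d + x + k * c = t" using t' kx by linarith
          then have "?d + x = 8 * (c * c) * 4 ^ p + r' * (c + 1) \<longleftrightarrow>
              K * c + r * (c + 1) = k * c + r' * (c + 1)" unfolding W t_def by linarith
          also have "\<dots> \<longleftrightarrow> (K + r) * c + r = (k + r') * c + r'" by (simp add: algebra_simps)
          also have "\<dots> \<longleftrightarrow> k = K \<and> r' = r"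
            using pair_code_eq[OF r that, of "K + r" "k + r'"] by auto
          finally show ?thesis .
        qed
        then have "(\<exists>r'<c. V r' x \<and> s r' = val (\<upsilon> k) x \<and> ?d + x = 8 * (c * c) * 4 ^ p + r' * (c + 1)) \<longleftrightarrow>
            k = K \<and> V r x \<and> s r = val (\<upsilon> K) x" using r by blast
        moreover have "val (\<upsilon> k) x < S" using val \<upsilon> k x by blast
        from cluster_string_match[where V = V, OF s x this d]
        have "Suc (x * S + val (\<upsilon> k) x) = ?G ?d \<longleftrightarrow>
            (\<exists>r'<c. V r' x \<and> s r' = val (\<upsilon> k) x \<and> ?d + x = 8 * (c * c) * 4 ^ p + r' * (c + 1))" .
        ultimately show ?thesis by blast
      qed
      then have "(\<Sum>k<?j. \<Sum>x<c. of_bool (Suc (x * S + val (\<upsilon> k) x) = ?G (t - (k * c + x))) :: nat) =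
          (\<Sum>k<?j. \<Sum>x<c. of_bool (k = K \<and> V r x \<and> s r = val (\<upsilon> K) x))"
        by (intro sum.cong refl) simp
      also have "\<dots> = (\<Sum>k<?j. if k = K then (\<Sum>x<c. of_bool (V r x \<and> s r = val (\<upsilon> K) x)) else 0)"
        by (intro sum.cong refl) simp
      finally show ?thesis using K by simp
    qed
    show "(\<Sum>x<c. of_bool (V r x \<and> s r = val (\<phi> K) x) :: nat) = (\<Sum>x<c. of_bool (V r x \<and> s r = val (\<psi> K) x))"
      using matches[of \<phi>] matches[of \<psi>] eq t B by simp
  qed
qed

section \<open>The permutation code\<close>

lemma fact_ge_power: "real k ^ i \<le> fact (k + i)"
proof (induction i)
  case (Suc i)
  have "real k * real k ^ i \<le> real (k + i + 1) * fact (k + i)"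
    using Suc by (intro mult_mono) auto
  then show ?case by (simp add: algebra_simps)
qed simp

text \<open>
  A block consists of permutations of \<open>2\<^sup>b\<close> values. The query \<open>(\<sigma>, \<rho>, y)\<close> asks for the value \<open>\<sigma>\<close>
  only, so it weighs the positions of \<open>\<sigma>\<close> in the permutations.
\<close>

lemma exists_permutation_code:
  fixes b :: nat
  assumes "b \<ge> 2"
  defines "c \<equiv> b * 2 ^ b * 2 ^ b"
  shows "\<exists>V s val (B :: (nat \<Rightarrow> nat \<Rightarrow> nat) set). finite B \<and> B \<noteq> {} \<and> real c * b / 8 \<le> log 2 (card B) \<and>
    (\<forall>r<c. s r < 2 ^ b) \<and> (\<forall>\<phi>\<in>B. \<forall>x<c. val \<phi> x < (2 :: nat) ^ b) \<and>
    (\<forall>\<phi>\<in>B. \<forall>\<psi>\<in>B. (\<forall>r<c. (\<Sum>x<c. of_bool (V r x \<and> s r = val \<phi> x) :: nat) =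
        (\<Sum>x<c. of_bool (V r x \<and> s r = val \<psi> x))) \<longrightarrow> \<phi> = \<psi>)"
proof -
  define S H :: nat where "S = 2 ^ b" and "H = 2 ^ (b - 1)"
  have SH: "S = 2 * H" and pos: "S > 0" "H > 0" "b > 0"
    unfolding S_def H_def using assms(1) by (simp_all flip: power_Suc)
  have c: "c = b * S * S" "c = b * H * S + b * H * S" by (simp_all add: c_def S_def[symmetric] SH)
  obtain W where weigh: "\<And>X X' :: nat \<Rightarrow> nat. (\<forall>g<b * H. X g < S \<and> X' g < S) \<Longrightarrow>
      (\<forall>\<rho><b. \<forall>y<S. (\<Sum>g<b * H. of_bool (W \<rho> y g (X g)) :: nat) = (\<Sum>g<b * H. of_bool (W \<rho> y g (X' g)))) \<Longrightarrow>
      (\<forall>g<b * H. X g = X' g)"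
    using exists_weighings[of b] pos unfolding S_def H_def by auto
  define B where "B = PiE {..<b * H} (\<lambda>_. {f. f permutes {..<S}})"
  \<comment> \<open>Permutations fill \<open>c / 2\<close> positions, but there are \<open>c\<close>
    queries and the block length has to equal their number. The rest is padding, which
    \<open>V\<close> never asks about.\<close>
  define val where "val \<phi> x = (if x < b * H * S then \<phi> (x div S) (x mod S) else 0)" for \<phi> :: "nat \<Rightarrow> nat \<Rightarrow> nat" and x
  \<comment> \<open>A query \<open>r\<close> is \<open>(\<sigma> * b + \<rho>) * S + y\<close>: a
    value, a copy of the matrix and a row.\<close>
  define s where "s r = r div (b * S)" for r
  define V where "V r x \<longleftrightarrow> x < b * H * S \<and> W (r div S mod b) (r mod S) (x div S) (x mod S)" for r x
  have perm: "\<phi> g permutes {..<S}" if "\<phi> \<in> B" "g < b * H" for \<phi> g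
    using that unfolding B_def by auto
  have cardB: "card B = fact S ^ (b * H)"
    unfolding B_def by (simp add: card_PiE card_permutations)
  have finB: "finite B" unfolding B_def by (intro finite_PiE) (auto simp: finite_permutations)
  moreover have "B \<noteq> {}" using cardB by (metis card.empty fact_nonzero power_not_zero)
  moreover have "real c * b / 8 \<le> log 2 (card B)"
  proof -
    \<comment> \<open>The crude \<open>H ^ H \<le> fact S\<close> still has order
      \<open>S * b\<close> bits; with \<open>c = 4 * b * H * H\<close> and
      \<open>b \<le> 2 * (b - 1)\<close> it gives the 8.\<close>
    have "real H * real (b - 1) = log 2 (real H ^ H)"
      by (simp add: H_def log_nat_power)
    also have "\<dots> \<le> log 2 (fact S)"
      using fact_ge_power[of H H] pos by (subst log_le_cancel_iff) (auto simp: SH mult_2)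
    finally have fact: "real H * real (b - 1) \<le> log 2 (fact S)" .
    have "real b \<le> 2 * real (b - 1)" using assms(1) by linarith
    then have "real c * b / 8 \<le> real c * (2 * real (b - 1)) / 8"
      by (intro divide_right_mono mult_left_mono) auto
    also have "\<dots> = real (b * H) * (real H * real (b - 1))" by (simp add: c(1) SH)
    also have "\<dots> \<le> real (b * H) * log 2 (fact S)" using fact by (intro mult_left_mono) auto
    also have "\<dots> = log 2 (card B)" by (simp add: cardB log_nat_power)
    finally show ?thesis .
  qed
  moreover have "\<forall>r<c. s r < 2 ^ b"
    unfolding s_def S_def[symmetric] c(1) using less_mult_imp_div_less by (metis mult.commute)
  moreover have "val \<phi> x < 2 ^ b" if "\<phi> \<in> B" "x < c" for \<phi> x
  proof (cases "x < b * H * S")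
    case True
    then have "x div S < b * H" by (simp add: less_mult_imp_div_less)
    from permutes_in_image[OF perm[OF that(1) this], of "x mod S"] have "\<phi> (x div S) (x mod S) < S"
      using pos by simp
    then show ?thesis using True by (simp add: val_def S_def)
  qed (simp add: val_def)
  moreover have "\<phi> = \<psi>"
    if B: "\<phi> \<in> B" "\<psi> \<in> B" and eq: "\<forall>r<c. (\<Sum>x<c. of_bool (V r x \<and> s r = val \<phi> x) :: nat) =
        (\<Sum>x<c. of_bool (V r x \<and> s r = val \<psi> x))" for \<phi> \<psi>
  proof -
    have agreement: "(\<Sum>x<c. of_bool (V r x \<and> s r = val \<upsilon> x) :: nat) = (\<Sum>g<b * H. of_bool (W \<rho> y g (inv (\<upsilon> g) \<sigma>)))"
      if \<upsilon>: "\<upsilon> \<in> B" and "\<sigma> < S" "\<rho> < b" "y < S" and r: "r = (\<sigma> * b + \<rho>) * S + y" for \<upsilon> \<sigma> \<rho> y r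
    proof -
      have r': "r div S = \<sigma> * b + \<rho>" "r mod S = y" "r div S mod b = \<rho>"
        unfolding r using that(3,4) by simp_all
      have "s r = \<sigma>"
        unfolding s_def mult.commute[of b S] div_mult2_eq r'(1) using that(3) by simp
      note r' = r' this
      have "(\<Sum>x<c. of_bool (V r x \<and> s r = val \<upsilon> x) :: nat) =
          (\<Sum>x<b * H * S. of_bool (W \<rho> y (x div S) (x mod S) \<and> \<sigma> = \<upsilon> (x div S) (x mod S)))"
        unfolding c(2) sum_lessThan_add by (simp add: V_def val_def r' that(3))
      also have "\<dots> = (\<Sum>g<b * H. \<Sum>p<S. of_bool (W \<rho> y g p \<and> \<sigma> = \<upsilon> g p))"
        unfolding sum_lessThan_times by (intro sum.cong refl) simp
      also have "\<dots> = (\<Sum>g<b * H. of_bool (W \<rho> y g (inv (\<upsilon> g) \<sigma>)))"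
      proof (rule sum.cong[OF refl])
        fix g assume "g \<in> {..<b * H}"
        then have p: "\<upsilon> g permutes {..<S}" using perm[OF \<upsilon>] by simp
        have "(\<Sum>p<S. of_bool (W \<rho> y g p \<and> \<sigma> = \<upsilon> g p) :: nat) =
            (\<Sum>p<S. if p = inv (\<upsilon> g) \<sigma> then of_bool (W \<rho> y g (inv (\<upsilon> g) \<sigma>)) else 0)"
          using permutes_inverses[OF p] by (intro sum.cong refl) auto
        also have "\<dots> = of_bool (W \<rho> y g (inv (\<upsilon> g) \<sigma>))"
          using permutes_in_image[OF permutes_inv[OF p], of \<sigma>] that(2) by simp
        finally show "(\<Sum>p<S. of_bool (W \<rho> y g p \<and> \<sigma> = \<upsilon> g p) :: nat) = of_bool (W \<rho> y g (inv (\<upsilon> g) \<sigma>))" .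
      qed
      finally show ?thesis .
    qed
    have inv_eq: "inv (\<phi> g) \<sigma> = inv (\<psi> g) \<sigma>" if "\<sigma> < S" "g < b * H" for \<sigma> g
    proof -
      have "\<forall>g<b * H. inv (\<phi> g) \<sigma> = inv (\<psi> g) \<sigma>"
      proof (rule weigh)
        show "\<forall>g<b * H. inv (\<phi> g) \<sigma> < S \<and> inv (\<psi> g) \<sigma> < S"
          using permutes_in_image[OF permutes_inv[OF perm[OF B(1)]], of _ \<sigma>]
            permutes_in_image[OF permutes_inv[OF perm[OF B(2)]], of _ \<sigma>] that(1) by simp
        show "\<forall>\<rho><b. \<forall>y<S. (\<Sum>g<b * H. of_bool (W \<rho> y g (inv (\<phi> g) \<sigma>)) :: nat) =
            (\<Sum>g<b * H. of_bool (W \<rho> y g (inv (\<psi> g) \<sigma>)))"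
        proof (intro allI impI)
          fix \<rho> y assume \<rho>: "\<rho> < b" and y: "y < S"
          define r where "r = (\<sigma> * b + \<rho>) * S + y"
          have "\<sigma> * b + \<rho> < S * b" by (rule pair_code_less) fact+
          then have "r < S * b * S" unfolding r_def using y by (rule pair_code_less)
          then have "r < c" by (simp add: c(1) mult_ac)
          with eq agreement[OF B(1) that(1) \<rho> y r_def] agreement[OF B(2) that(1) \<rho> y r_def]
          show "(\<Sum>g<b * H. of_bool (W \<rho> y g (inv (\<phi> g) \<sigma>)) :: nat) =
            (\<Sum>g<b * H. of_bool (W \<rho> y g (inv (\<psi> g) \<sigma>)))" by simp
        qed
      qed
      with that show ?thesis by blast
    qed
    show "\<phi> = \<psi>"
    proof (rule PiE_ext[OF B[unfolded B_def]])
      fix g assume "g \<in> {..<b * H}"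
      then have g: "g < b * H" by simp
      note p = perm[OF B(1) g] perm[OF B(2) g]
      show "\<phi> g = \<psi> g"
      proof
        fix x
        show "\<phi> g x = \<psi> g x"
        proof (cases "x < S")
          case True
          then have "\<phi> g x < S" using permutes_in_image[OF p(1), of x] by simp
          from inv_eq[OF this g] have "x = inv (\<psi> g) (\<phi> g x)" using permutes_inverses(2)[OF p(1)] by simp
          then show ?thesis using permutes_inverses(1)[OF p(2)] by metis
        next
          case False
          then show ?thesis using permutes_not_in[OF p(1)] permutes_not_in[OF p(2)] by simp
        qed
      qed
    qed
  qed
  ultimately show ?thesis
    by (intro exI[of _ V] exI[of _ s] exI[of _ val] exI[of _ B] conjI ballI impI) blast+
qed

text \<open>\<open>b / 16\<close> arises from the \<open>b / 8\<close> bits per symbol of the code,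
  as half of the blocks are free. Clusters sit at powers of 4, so only even exponents of 2 serve as
  scales.\<close>

lemma exists_hard_cluster_string:
  fixes b n q N :: nat
  defines "c \<equiv> b * 2 ^ b * 2 ^ b"
  assumes "b \<ge> 2" "n \<ge> 1" and q: "c * 2 ^ b < q" and scales: "\<And>p. p < N \<Longrightarrow> 16 * (c * c) * 4 ^ p \<le> n"
  shows "\<exists>G. (\<forall>d. G d < q) \<and> (\<forall>(w :: nat) R m. randomised_solves_online_hamming w q (map (\<lambda>i. G (n - 1 - i)) [0..<n]) R \<longrightarrow>
    w \<ge> 1 \<longrightarrow> 2 * n \<le> m \<longrightarrow>
    (\<exists>xs\<in>strings q m. ennreal (real N * (b / 16) / (64 * w)) \<le> expected_amortised_time R xs))"
proof -
  define S :: nat where "S = 2 ^ b"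
  have c_S: "c = b * S * S" by (simp add: c_def S_def)
  obtain V s val and B :: "(nat \<Rightarrow> nat \<Rightarrow> nat) set"
    where code: "finite B \<and> B \<noteq> {} \<and> real c * b / 8 \<le> log 2 (card B) \<and>
      (\<forall>r<c. s r < S) \<and> (\<forall>\<phi>\<in>B. \<forall>x<c. val \<phi> x < S) \<and>
      (\<forall>\<phi>\<in>B. \<forall>\<psi>\<in>B. (\<forall>r<c. (\<Sum>x<c. of_bool (V r x \<and> s r = val \<phi> x) :: nat) =
          (\<Sum>x<c. of_bool (V r x \<and> s r = val \<psi> x))) \<longrightarrow> \<phi> = \<psi>)"
    using exists_permutation_code[OF assms(2)] unfolding S_def[symmetric] unfolding c_S[symmetric]
    by (elim exE) (rule that)
  then have B: "finite B" "B \<noteq> {}" "real c * b / 8 \<le> log 2 (card B)"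
    and s: "\<And>r. r < c \<Longrightarrow> s r < S" and val: "\<And>\<phi> x. \<phi> \<in> B \<Longrightarrow> x < c \<Longrightarrow> val \<phi> x < S"
    by simp_all
  have inj: "\<phi> = \<psi>" if "\<phi> \<in> B" "\<psi> \<in> B" "\<And>r. r < c \<Longrightarrow> (\<Sum>x<c. of_bool (V r x \<and> s r = val \<phi> x) :: nat) =
      (\<Sum>x<c. of_bool (V r x \<and> s r = val \<psi> x))" for \<phi> \<psi>
    using code[THEN conjunct2, THEN conjunct2, THEN conjunct2, THEN conjunct2, THEN conjunct2, rule_format, OF that(1,2)] that(3)
    by blast
  let ?G = "cluster_string c S V s"
  have c1: "c \<ge> 1" using assms(2) by (simp add: c_def)
  have q': "c * S < q" using q by (simp add: S_def)
  have "\<exists>xs\<in>strings q m. ennreal (real N * (b / 16) / (64 * w)) \<le> expected_amortised_time R xs"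
    if R: "randomised_solves_online_hamming w q (map (\<lambda>i. ?G (n - 1 - i)) [0..<n]) R" and w: "w \<ge> 1"
      and m: "2 * n \<le> m" for w :: nat and R m
  proof -
    let ?P = "(\<lambda>p. 2 * p) ` {..<N}"
    have card: "card ?P = N" by (simp add: card_image inj_on_def)
    have "\<exists>xs\<in>strings q m. ennreal (real (card ?P) * (b / 16) / (64 * w)) \<le> expected_amortised_time R xs"
    proof (rule exists_hard_block_stream[OF R w assms(3) _ c1 _ m B(1,2),
          where l = "8 * c" and j = "\<lambda>e. 4 * c * 2 ^ e" and emb = "\<lambda>\<phi> x. Suc (x * S + val \<phi> x)" and \<kappa> = "b / 16"])
      show "q \<ge> 1" "8 * c \<ge> 1" using q c1 by auto
      show "Suc (x * S + val \<phi> x) < q" if "\<phi> \<in> B" "x < c" for \<phi> x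
        using pair_code_less[OF that(2) val[OF that]] q' by simp
      show "finite ?P" by simp
      fix e assume "e \<in> ?P"
      then obtain p where p: "e = 2 * p" "p < N" by auto
      have e: "(2::nat) ^ e = 4 ^ p" by (simp add: p(1) power_mult)
      show "2 * (8 * c * 2 ^ e * c) \<le> n" using scales[OF p(2)] by (simp add: e mult_ac)
      show "4 * c * 2 ^ e \<le> 8 * c * 2 ^ e" by simp
      show "decodable ?G c (\<lambda>\<phi> x. Suc (x * S + val \<phi> x)) B (8 * c * 2 ^ e) (4 * c * 2 ^ e)"
        unfolding e by (rule decodable_cluster_string[OF s val inj])
      have "b / 16 * real (8 * c * 2 ^ e * c) = real (4 * c * 2 ^ e) * (real c * b / 8)"
        by simp
      also have "\<dots> \<le> real (4 * c * 2 ^ e) * log 2 (card B)" using B(3) by (intro mult_left_mono) auto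
      finally show "b / 16 * real (8 * c * 2 ^ e * c) \<le> real (4 * c * 2 ^ e) * log 2 (card B)" .
    qed simp
    then show ?thesis unfolding card .
  qed
  moreover have "?G d < q" for d by (rule cluster_string_less[OF s q'])
  ultimately show ?thesis by (intro exI[of _ ?G]) blast
qed

section \<open>Choice of parameters and assembly of the bound\<close>

theorem theorem3:
  fixes c\<^sub>0 :: real
  assumes "c\<^sub>0 > 0"
  shows "\<exists>c>0. \<forall>(q::nat) (n::nat) (w::nat) (R :: nat list \<Rightarrow> algorithm measure).
           q \<ge> 1 \<longrightarrow> n \<ge> 1 \<longrightarrow> w \<ge> 1 \<longrightarrow> real w \<ge> c\<^sub>0 * log 2 (real n) \<longrightarrow>
           (\<forall>F\<in>strings q n. randomised_solves_online_hamming w q F (R F)) \<longrightarrow>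
           (\<exists>F\<in>strings q n. \<forall>m\<ge>2 * n. \<exists>xs\<in>strings q m.
              expected_amortised_time (R F) xs
                \<ge> ennreal (c * (of_int (delta q n) / real w * log 2 (real n))))"
proof (intro exI[of _ "1 / 10 ^ 6"] conjI allI impI)
  fix q n w :: nat and R :: "nat list \<Rightarrow> algorithm measure"
  assume q: "q \<ge> 1" and n: "n \<ge> 1" and w: "w \<ge> 1"
    and R: "\<forall>F\<in>strings q n. randomised_solves_online_hamming w q F (R F)"
  define L where "L = min (log 2 (real q)) (log 2 (real n))"
  \<comment> \<open>The last case dictates the constant: \<open>delta q n \<le> 96 * b\<close> and
    \<open>log 2 n \<le> 8 * N\<close> meet \<open>N * b / (1024 * w)\<close>, and
    \<open>96 * 8 * 1024\<close> is below \<open>10 ^ 6\<close>.\<close>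
  define bound where "bound = 1 / 10 ^ 6 * (of_int (delta q n) / real w * log 2 (real n))"
  have logn: "log 2 (real n) \<ge> 0" using n by simp
  have delta: "delta q n = \<lceil>L\<rceil>" by (simp add: delta_def L_def)
  have strings: "map (\<lambda>i. G (n - 1 - i)) [0..<n] \<in> strings q n" if "\<And>d. G d < q" for G
    using that by (auto simp: strings_def)
  \<comment> \<open>\<open>G\<close> is fixed before \<open>m\<close>: one string is hard for all
    stream lengths.\<close>
  have reduce: "\<exists>F\<in>strings q n. \<forall>m\<ge>2 * n. \<exists>xs\<in>strings q m. ennreal bound \<le> expected_amortised_time (R F) xs"
    if G: "\<And>d. G d < q" and T: "bound \<le> T"
      and hard: "\<And>m R'. randomised_solves_online_hamming w q (map (\<lambda>i. G (n - 1 - i)) [0..<n]) R' \<Longrightarrow> 2 * n \<le> m \<Longrightarrow>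
        \<exists>xs\<in>strings q m. ennreal T \<le> expected_amortised_time R' xs" for G T
  proof (rule bexI[OF _ strings[OF G]], intro allI impI)
    fix m assume "2 * n \<le> m"
    from hard[OF R[rule_format, OF strings[OF G]] this] ennreal_leI[OF T]
    show "\<exists>xs\<in>strings q m. ennreal bound \<le> expected_amortised_time (R (map (\<lambda>i. G (n - 1 - i)) [0..<n])) xs"
      by (meson order.trans)
  qed
  \<comment> \<open>Below 48 the constant absorbs delta and a binary string suffices; from 48 on,
    \<open>L / 24\<close> is at least the 2 that the permutation code requires of
    \<open>b\<close>.\<close>
  consider "q = 1 \<or> n = 1" | "q \<ge> 2" "n \<ge> 2" "L < 48" | "L \<ge> 48" using q n by linarith
  then have "\<exists>F\<in>strings q n. \<forall>m\<ge>2 * n. \<exists>xs\<in>strings q m. ennreal bound \<le> expected_amortised_time (R F) xs"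
  proof cases
    case 1
    then have "bound = 0" using logn by (auto simp: bound_def delta L_def min_def)
    moreover have "replicate k 0 \<in> strings q k" for k using q by (auto simp: strings_def)
    ultimately show ?thesis by auto
  next
    case 2
    have "log_parity d < q" for d using 2(1) by (simp add: log_parity_def less_le_trans[of _ 2])
    moreover have "bound \<le> log 2 n / (128 * w)"
    proof -
      have "of_int (delta q n) \<le> (48 :: real)" using 2(3) ceiling_le[of L 48] by (simp add: delta)
      have "bound = 1 / 10 ^ 6 * (of_int (delta q n) * (log 2 n / w))" by (simp add: bound_def)
      also have "\<dots> \<le> 1 / 10 ^ 6 * (48 * (log 2 n / w))"
        using \<open>of_int (delta q n) \<le> 48\<close> logn by (intro mult_left_mono mult_right_mono) auto
      also have "\<dots> = 48 / 10 ^ 6 * (log 2 n / w)" by simp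
      also have "\<dots> \<le> 1 / 128 * (log 2 n / w)" using logn by (intro mult_right_mono) auto
      finally show ?thesis by simp
    qed
    ultimately show ?thesis
      by (rule reduce) (rule exists_hard_binary_stream, use w 2 in auto)
  next
    case 3
    \<comment> \<open>Room is needed twice: \<open>4 * b\<close> bits in the alphabet, and
      \<open>4 + 6 * b + 2 * N \<le> log 2 n\<close> for the largest cluster, with \<open>N\<close>
      about a quarter of \<open>log 2 n\<close>. As \<open>L / 24 \<ge> 2\<close>, the floor loses
      at most a factor 2.\<close>
    define b where "b = nat \<lfloor>L / 24\<rfloor>"
    define c where "c = b * 2 ^ b * 2 ^ b"
    define N where "N = nat \<lfloor>log 2 n / 4\<rfloor>"
    have b: "b \<ge> 2" "24 * real b \<le> L" "L / 48 \<le> b" using 3 unfolding b_def by linarith+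
    have Ln: "L \<le> log 2 n" and Lq: "L \<le> log 2 q" by (simp_all add: L_def)
    have N: "4 * real N \<le> log 2 n" "log 2 n / 8 \<le> N" using 3 Ln unfolding N_def by linarith+
    have b2: "b < 2 ^ b" by (rule less_exp)
    have "c * 2 ^ b < 2 ^ b * 2 ^ b * 2 ^ b * 2 ^ b" unfolding c_def using b2 by simp
    also have "\<dots> = 2 ^ (4 * b)" by (simp flip: power_add)
    also have "2 ^ (4 * b) \<le> q" by (rule power_le_if_le_log2) (use b(2) 3 Lq q in auto)
    finally have cq: "c * 2 ^ b < q" .
    have scales: "16 * (c * c) * 4 ^ p \<le> n" if "p < N" for p
    proof -
      have "c \<le> 2 ^ b * 2 ^ b * 2 ^ b" unfolding c_def using b2 by simp
      also have "\<dots> = 2 ^ (3 * b)" by (simp flip: power_add)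
      finally have c8: "c \<le> 2 ^ (3 * b)" .
      have "c * c \<le> 2 ^ (3 * b) * 2 ^ (3 * b)" by (rule mult_le_mono[OF c8 c8])
      moreover have "(4::nat) ^ p \<le> 4 ^ N" using that by (intro power_increasing) auto
      ultimately have "16 * (c * c) * 4 ^ p \<le> 16 * (2 ^ (3 * b) * 2 ^ (3 * b)) * 4 ^ N"
        by (rule mult_le_mono[OF mult_le_mono2])
      also have "\<dots> = 2 ^ (4 + 6 * b + 2 * N)" by (simp add: power_add power_mult flip: power_mult_distrib)
      also have "2 ^ (4 + 6 * b + 2 * N) \<le> n"
        by (rule power_le_if_le_log2) (use b(2) 3 Ln N(1) n in auto)
      finally show ?thesis .
    qed
    from exists_hard_cluster_string[OF b(1) n cq[unfolded c_def] scales[unfolded c_def]]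
    obtain G where G: "\<And>d. G d < q" and hard: "\<And>(w :: nat) R m. randomised_solves_online_hamming w q (map (\<lambda>i. G (n - 1 - i)) [0..<n]) R \<Longrightarrow>
        w \<ge> 1 \<Longrightarrow> 2 * n \<le> m \<Longrightarrow> \<exists>xs\<in>strings q m. ennreal (real N * (b / 16) / (64 * w)) \<le> expected_amortised_time R xs"
      by blast
    have "bound \<le> real N * (b / 16) / (64 * w)"
    proof -
      have "of_int (delta q n) \<le> 96 * real b" using 3 b(3) unfolding delta by linarith
      have "bound = 1 / 10 ^ 6 * (of_int (delta q n) * log 2 n / w)" by (simp add: bound_def)
      also have "\<dots> \<le> 1 / 10 ^ 6 * ((96 * real b) * (8 * real N) / w)"
        using \<open>of_int (delta q n) \<le> 96 * real b\<close> N(2) logn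
        by (intro mult_left_mono divide_right_mono mult_mono) auto
      also have "\<dots> = 768 / 10 ^ 6 * (real b * real N / w)" by simp
      also have "\<dots> \<le> 1 / 1024 * (real b * real N / w)" by (intro mult_right_mono) auto
      finally show ?thesis by (simp add: mult.commute)
    qed
    with G show ?thesis by (rule reduce) (rule hard, use w in auto)
  qed
  then show "\<exists>F\<in>strings q n. \<forall>m\<ge>2 * n. \<exists>xs\<in>strings q m.
      ennreal (1 / 10 ^ 6 * (of_int (delta q n) / real w * log 2 (real n))) \<le> expected_amortised_time (R F) xs"
    unfolding bound_def .
qed simp

end
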